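(* Let $\phi$ be an injective endomorphism of a free group $F_n$ of rank $n\ge1$, and let $\operatorname{tr}(\phi^{\mathrm{ab}})$ be the trace of the induced endomorphism $\phi^{\mathrm{ab}}\colon\mathbb Z^n\to\mathbb Z^n$ of the abelianization. If $\operatorname{tr}(\phi^{\mathrm{ab}})<1$, then there exists $c\in F_n$ such that $\operatorname{rk}\mathrm{Fix}(i_c\circ\phi)=a(i_c\circ\phi)=0$. If $n\le2$ and $\operatorname{tr}(\phi^{\mathrm{ab}})>1$, then there exists $c\in F_n$ such that $\operatorname{rk}\mathrm{Fix}(i_c\circ\phi)+a(i_c\circ\phi)>1$.
   Context: $i_c\colon F_n\to F_n$, $g\mapsto cgc^{-1}$. For an injective endomorphism $\psi$ of a free group $F$ (with a fixed basis; elements are reduced words, $|W|$ word length, $\partial F$ the set of infinite reduced words $W=w_1w_2\cdots$ with $W_i=w_1\cdots w_i$, $W\wedge V$ the longest common initial segment), $\psi$ extends to $\partial F$ by $\psi(W)=\lim_i\psi(W_i)$. A fixed infinite word $W$ of $\psi$ is attracting if $|W\wedge\psi(W_i)|-i\to+\infty$. $\mathrm{Fix}(\psi)=\{g:\psi(g)=g\}$; fixed infinite words $W,W'$ are equivalent if $W'=UW$ with $U\in\mathrm{Fix}(\psi)$; $a(\psi)$ is the number of equivalence classes of attracting fixed words; $\operatorname{rk}$ is the minimal number of generators. *)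

theory Defs
  imports Main "HOL-Library.Extended_Nat"
begin

text \<open>Free group F_n on the basis x_0, ..., x_(n-1).  A letter is a pair (i, b):
  (i, True) stands for x_i and (i, False) for its inverse.  Group elements are
  freely reduced words (lists of letters).\<close>

type_synonym letter = "nat \<times> bool"
type_synonym word = "letter list"
type_synonym infword = "nat \<Rightarrow> letter"

definition inv_letter :: "letter \<Rightarrow> letter" where
  "inv_letter x = (fst x, \<not> snd x)"

fun reduced :: "word \<Rightarrow> bool" where
  "reduced [] = True"
| "reduced [x] = True"
| "reduced (x # y # ys) = (y \<noteq> inv_letter x \<and> reduced (y # ys))"

definition Fn :: "nat \<Rightarrow> word set" where
  "Fn n = {w. reduced w \<and> (\<forall>x\<in>set w. fst x < n)}"

fun cons_red :: "letter \<Rightarrow> word \<Rightarrow> word" where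
  "cons_red x [] = [x]"
| "cons_red x (y # ys) = (if y = inv_letter x then ys else x # y # ys)"

definition mult :: "word \<Rightarrow> word \<Rightarrow> word" where
  "mult u v = foldr cons_red u v"

definition inverse_w :: "word \<Rightarrow> word" where
  "inverse_w w = rev (map inv_letter w)"

definition img_letter :: "(nat \<Rightarrow> word) \<Rightarrow> letter \<Rightarrow> word" where
  "img_letter f x = (if snd x then f (fst x) else inverse_w (f (fst x)))"

definition hom :: "(nat \<Rightarrow> word) \<Rightarrow> word \<Rightarrow> word" where
  "hom f w = foldr (\<lambda>x acc. mult (img_letter f x) acc) w []"

definition is_injective_endo :: "nat \<Rightarrow> (nat \<Rightarrow> word) \<Rightarrow> bool" where
  "is_injective_endo n f \<longleftrightarrow> (\<forall>j<n. f j \<in> Fn n) \<and> inj_on (hom f) (Fn n)"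

definition conj_endo :: "word \<Rightarrow> (nat \<Rightarrow> word) \<Rightarrow> (nat \<Rightarrow> word)" where
  "conj_endo c f = (\<lambda>j. mult c (mult (f j) (inverse_w c)))"

text \<open>Exponent sum of the generator x_i in a word; the matrix of phi^ab has
  (i,j)-entry expsum i (f j), so its trace is the following.\<close>
definition expsum :: "nat \<Rightarrow> word \<Rightarrow> int" where
  "expsum i w = (\<Sum>x\<leftarrow>w. if fst x = i then (if snd x then 1 else -1) else 0)"

definition trace_ab :: "nat \<Rightarrow> (nat \<Rightarrow> word) \<Rightarrow> int" where
  "trace_ab n f = (\<Sum>j<n. expsum j (f j))"

text \<open>Fixed subgroup, generated subgroups, and rank (minimal number of generators;
  \<infinity> if not finitely generated).\<close>
definition Fix :: "nat \<Rightarrow> (nat \<Rightarrow> word) \<Rightarrow> word set" where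
  "Fix n f = {g \<in> Fn n. hom f g = g}"

inductive_set gen :: "word set \<Rightarrow> word set" for S where
  gen_one: "[] \<in> gen S"
| gen_base: "s \<in> S \<Longrightarrow> s \<in> gen S"
| gen_mult: "x \<in> gen S \<Longrightarrow> y \<in> gen S \<Longrightarrow> mult x y \<in> gen S"
| gen_inv: "x \<in> gen S \<Longrightarrow> inverse_w x \<in> gen S"

definition rk :: "nat \<Rightarrow> word set \<Rightarrow> enat" where
  "rk n H = (INF S \<in> {S. finite S \<and> S \<subseteq> Fn n \<and> gen S = H}. enat (card S))"

definition inf_words :: "nat \<Rightarrow> infword set" where
  "inf_words n = {W. (\<forall>j. fst (W j) < n) \<and> (\<forall>j. W (Suc j) \<noteq> inv_letter (W j))}"

definition prefix :: "nat \<Rightarrow> infword \<Rightarrow> word" where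
  "prefix i W = map W [0..<i]"

definition lcp_len :: "infword \<Rightarrow> word \<Rightarrow> nat" where
  "lcp_len W v = (LEAST k. k = length v \<or> v ! k \<noteq> W k)"

definition converges_to :: "(nat \<Rightarrow> word) \<Rightarrow> infword \<Rightarrow> bool" where
  "converges_to s W \<longleftrightarrow> (\<forall>k. \<exists>N. \<forall>i\<ge>N. k \<le> length (s i) \<and> take k (s i) = prefix k W)"

definition fixed_inf :: "nat \<Rightarrow> (nat \<Rightarrow> word) \<Rightarrow> infword \<Rightarrow> bool" where
  "fixed_inf n f W \<longleftrightarrow> W \<in> inf_words n \<and> converges_to (\<lambda>i. hom f (prefix i W)) W"

definition attracting :: "nat \<Rightarrow> (nat \<Rightarrow> word) \<Rightarrow> infword \<Rightarrow> bool" where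
  "attracting n f W \<longleftrightarrow> fixed_inf n f W \<and>
     filterlim (\<lambda>i. int (lcp_len W (hom f (prefix i W))) - int i) at_top sequentially"

definition inf_mult :: "word \<Rightarrow> infword \<Rightarrow> infword" where
  "inf_mult u W = (let k = (GREATEST k. k \<le> length u \<and>
                              drop (length u - k) u = inverse_w (prefix k W));
                        m = length u - k
                    in (\<lambda>j. if j < m then u ! j else W (j - m + k)))"

definition fix_equiv :: "nat \<Rightarrow> (nat \<Rightarrow> word) \<Rightarrow> (infword \<times> infword) set" where
  "fix_equiv n f = {(W, W'). \<exists>U\<in>Fix n f. W' = inf_mult U W}"

definition ecard :: "'a set \<Rightarrow> enat" where
  "ecard A = (if finite A then enat (card A) else \<infinity>)"

definition a_num :: "nat \<Rightarrow> (nat \<Rightarrow> word) \<Rightarrow> enat" where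
  "a_num n f = ecard ({W. attracting n f W} // fix_equiv n f)"

end

theory Submission
  imports Defs
begin

text \<open>Let \<open>g\<close> act from the right on \<open>F\<^sub>n\<close> by \<open>c \<cdot> g = g\<^sup>-\<^sup>1 c \<phi>(g)\<close> and consider the graph with vertex set
  \<open>F\<^sub>n\<close> and an edge from \<open>c\<close> to \<open>c \<cdot> x\<^sub>j\<close> for every \<open>c\<close> and \<open>j\<close>. The fundamental group of the component of \<open>c\<close> is
  \<open>Fix (i\<^sub>c \<phi>)\<close>. Let every \<open>c \<noteq> 1\<close> choose the edge of its first letter and follow it. Edges that nobody
  chooses correspond to the occurrences of \<open>x\<^sub>j\<close> in \<open>\<phi>(x\<^sub>j)\<close>, edges chosen by both ends to those
  of \<open>x\<^sub>j\<^sup>-\<^sup>1\<close>. Define the index of a component as (1 if it contains the vertex 1) + (number of edges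
  chosen twice) - (number of unchosen edges); the indices add up to \<open>1 - tr \<phi>\<^sup>a\<^sup>b\<close>. A finite connected
  subgraph that contains all exceptional places of its component has Euler characteristic equal to
  the index plus the number of vertices at which the flow leaves it.

  If the trace is less than 1, some component has index at least 1. As a connected graph has Euler
  characteristic at most 1, that component is a tree in which no flow leaves a large subtree, whereas
  the path of an attracting word follows the flow eventually and runs off to infinity. If the trace
  exceeds 1, some component has index at most -1. Choose the subgraph so that as few flow lines as
  possible leave it; then they never return or merge, and each one spells an attracting word. The
  number of these lines and the rank of the subgraph add up to at least 2.\<close>

section \<open>Reduced words\<close>

lemma inv_letter_inv_letter [simp]: "inv_letter (inv_letter x) = x"
  by (simp add: inv_letter_def)

lemma fst_inv_letter [simp]: "fst (inv_letter x) = fst x"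
  by (simp add: inv_letter_def)

lemma snd_inv_letter [simp]: "snd (inv_letter x) = (\<not> snd x)"
  by (simp add: inv_letter_def)

lemma inv_letter_neq [simp]: "inv_letter x \<noteq> x" "x \<noteq> inv_letter x"
  by (metis snd_inv_letter)+

lemma inv_letter_eq_iff: "inv_letter x = y \<longleftrightarrow> x = inv_letter y"
  by auto

lemma reduced_Cons: "reduced (x # w) \<longleftrightarrow> (w = [] \<or> hd w \<noteq> inv_letter x) \<and> reduced w"
  by (cases w) auto

lemma reduced_append:
  "reduced (u @ v) \<longleftrightarrow>
     reduced u \<and> reduced v \<and> (u = [] \<or> v = [] \<or> hd v \<noteq> inv_letter (last u))"
  by (induction u) (auto simp: reduced_Cons)

lemma reduced_inverse_w [simp]: "reduced (inverse_w w) = reduced w"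
  unfolding inverse_w_def
  by (induction w) (auto simp: reduced_Cons reduced_append last_rev hd_map inv_letter_eq_iff)

lemma inverse_w_Nil [simp]: "inverse_w [] = []"
  by (simp add: inverse_w_def)

lemma inverse_w_Nil_iff [simp]: "inverse_w w = [] \<longleftrightarrow> w = []"
  by (simp add: inverse_w_def)

lemma inverse_w_Cons: "inverse_w (x # w) = inverse_w w @ [inv_letter x]"
  by (simp add: inverse_w_def)

lemma inverse_w_append [simp]: "inverse_w (u @ v) = inverse_w v @ inverse_w u"
  by (simp add: inverse_w_def)

lemma inverse_w_inverse_w [simp]: "inverse_w (inverse_w w) = w"
  by (simp add: inverse_w_def rev_map o_def)

lemma length_inverse_w [simp]: "length (inverse_w w) = length w"
  by (simp add: inverse_w_def)

lemma last_inverse_w: "w \<noteq> [] \<Longrightarrow> last (inverse_w w) = inv_letter (hd w)"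
  by (simp add: inverse_w_def last_rev hd_map)

lemma set_inverse_w: "set (inverse_w w) = inv_letter ` set w"
  by (simp add: inverse_w_def)

section \<open>Multiplication of reduced words\<close>

lemma reduced_cons_red: "reduced v \<Longrightarrow> reduced (cons_red x v)"
  by (cases v) (auto simp: reduced_Cons)

lemma cons_red_reduced: "reduced (x # v) \<Longrightarrow> cons_red x v = x # v"
  by (cases v) auto

lemma cons_red_inv_cancel:
  assumes "reduced v"
  shows "cons_red (inv_letter x) (cons_red x v) = v"
proof (cases v)
  case (Cons y ys)
  then show ?thesis using assms by (cases ys) auto
qed simp

lemma mult_Nil [simp]: "mult [] v = v"
  by (simp add: mult_def)

lemma mult_Cons: "mult (x # u) v = cons_red x (mult u v)"
  by (simp add: mult_def)

lemma mult_append: "mult (u @ w) v = mult u (mult w v)"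
  by (simp add: mult_def)

lemma reduced_mult: "reduced v \<Longrightarrow> reduced (mult u v)"
  by (induction u) (auto simp: mult_Cons reduced_cons_red)

text \<open>Inverse letters act on reduced words by mutually inverse maps, so carrying out a
  cancellation inside the left factor does not change its action on \<open>v\<close>.\<close>

lemma mult_cons_red:
  assumes "reduced v"
  shows "mult (cons_red x u) v = cons_red x (mult u v)"
proof (cases u)
  case (Cons y ys)
  then show ?thesis
    using cons_red_inv_cancel[OF reduced_mult[OF assms], of "inv_letter x" ys]
    by (auto simp: mult_Cons)
qed (simp add: mult_Cons)

lemma mult_assoc:
  assumes "reduced v"
  shows "mult (mult u w) v = mult u (mult w v)"
  by (induction u) (simp_all add: mult_Cons mult_cons_red assms)

lemma mult_eq_append: "reduced (u @ v) \<Longrightarrow> mult u v = u @ v"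
  by (induction u) (auto simp: mult_Cons cons_red_reduced reduced_Cons)

lemma mult_Nil2: "reduced u \<Longrightarrow> mult u [] = u"
  by (simp add: mult_eq_append)

lemma mult_inverse_cancel: "reduced v \<Longrightarrow> mult (inverse_w u) (mult u v) = v"
  by (induction u arbitrary: v)
     (simp_all add: inverse_w_Cons mult_append mult_Cons cons_red_inv_cancel reduced_mult)

lemma mult_inverse_cancel': "reduced v \<Longrightarrow> mult u (mult (inverse_w u) v) = v"
  using mult_inverse_cancel[of v "inverse_w u"] by simp

lemma mult_inverse_left: "reduced u \<Longrightarrow> mult (inverse_w u) u = []"
  using mult_inverse_cancel[of "[]" u] by (simp add: mult_Nil2)

lemma mult_inverse_right: "reduced u \<Longrightarrow> mult u (inverse_w u) = []"
  using mult_inverse_left[of "inverse_w u"] by simp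

lemma inverse_w_cons_red:
  "reduced v \<Longrightarrow> inverse_w (cons_red x v) = mult (inverse_w v) [inv_letter x]"
proof (cases v)
  case (Cons y ys)
  assume v: "reduced v"
  show ?thesis
  proof (cases "y = inv_letter x")
    case True
    then show ?thesis using Cons v
      by (simp add: inverse_w_Cons mult_append mult_Cons mult_Nil2 reduced_Cons)
  next
    case False
    have "reduced (inverse_w v @ [inv_letter x])"
      using Cons v False reduced_inverse_w[of "x # v"]
      by (simp add: inverse_w_Cons reduced_Cons)
    from mult_eq_append[OF this] Cons False show ?thesis
      by (simp add: inverse_w_Cons)
  qed
qed (simp add: inverse_w_Cons)

lemma inverse_w_mult:
  assumes "reduced u" "reduced v"
  shows "inverse_w (mult u v) = mult (inverse_w v) (inverse_w u)"
  using assms(1)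
proof (induction u)
  case Nil
  then show ?case using assms by (simp add: mult_Nil2)
next
  case (Cons x u)
  have "reduced (inverse_w u @ [inv_letter x])"
    using Cons.prems reduced_inverse_w[of "x # u"] by (simp add: inverse_w_Cons del: reduced_inverse_w)
  moreover have "inverse_w (mult (x # u) v) = mult (mult (inverse_w v) (inverse_w u)) [inv_letter x]"
    using Cons assms by (simp add: mult_Cons inverse_w_cons_red reduced_mult reduced_Cons)
  ultimately show ?case
    by (simp add: mult_assoc mult_eq_append inverse_w_Cons)
qed

text \<open>Cancellation happens only at the junction, between a suffix \<open>r\<close> of
  \<open>t\<close> and its inverse at the front of \<open>s\<close>. Naming \<open>r\<close> allows
  the head of a product to be traced back to one of the factors.\<close>

lemma mult_decomp:
  assumes "reduced t"
  shows "\<exists>t' r s'. t = t' @ r \<and> s = inverse_w r @ s' \<and> mult t s = t' @ s'"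
  using assms
proof (induction t)
  case (Cons x t)
  then obtain t' r s' where *: "t = t' @ r" "s = inverse_w r @ s'" "mult t s = t' @ s'"
    by (auto simp: reduced_Cons)
  \<comment> \<open>As \<open>x # t\<close> is reduced, \<open>x\<close> can cancel only when
    nothing of \<open>t\<close> is left.\<close>
  have "mult (x # t) s = x # t' @ s'" if "t' \<noteq> [] \<or> s' = [] \<or> hd s' \<noteq> inv_letter x"
    using * Cons.prems that by (cases t'; cases s') (auto simp: mult_Cons reduced_Cons)
  then consider "t' = []" "s' \<noteq> []" "hd s' = inv_letter x" | "mult (x # t) s = x # t' @ s'"
    by blast
  then show ?case
  proof cases
    case 1
    then have "x # t = [] @ (x # r)" "s = inverse_w (x # r) @ tl s'" "mult (x # t) s = [] @ tl s'"
      using * by (cases s'; auto simp: mult_Cons inverse_w_Cons)+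
    then show ?thesis by blast
  next
    case 2
    then have "x # t = (x # t') @ r" "mult (x # t) s = (x # t') @ s'" using * by auto
    then show ?thesis using * by blast
  qed
qed auto

lemma take_mult:
  assumes "reduced t" "l + length s \<le> length t"
  shows "take l (mult t s) = take l t" "l \<le> length (mult t s)"
proof -
  obtain t' r s' where *: "t = t' @ r" "s = inverse_w r @ s'" "mult t s = t' @ s'"
    using mult_decomp[OF assms(1)] by blast
  then have "l \<le> length t'" using assms by simp
  then show "take l (mult t s) = take l t" "l \<le> length (mult t s)" using * by auto
qed

subsection \<open>The group $F_n$\<close>

lemma FnD: "w \<in> Fn n \<Longrightarrow> reduced w" "w \<in> Fn n \<Longrightarrow> x \<in> set w \<Longrightarrow> fst x < n"
  by (auto simp: Fn_def)

lemma Fn_letters: "w \<in> Fn n \<Longrightarrow> \<forall>x\<in>set w. fst x < n"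
  by (auto simp: Fn_def)

lemma Nil_in_Fn [simp]: "[] \<in> Fn n"
  by (simp add: Fn_def)

lemma Fn_Cons: "x # w \<in> Fn n \<longleftrightarrow> fst x < n \<and> (w = [] \<or> hd w \<noteq> inv_letter x) \<and> w \<in> Fn n"
  by (auto simp: Fn_def reduced_Cons)

lemma hd_Fn: "w \<in> Fn n \<Longrightarrow> w \<noteq> [] \<Longrightarrow> fst (hd w) < n"
  by (cases w) (auto simp: Fn_Cons)

lemma Fn_append: 
  "u @ v \<in> Fn n \<longleftrightarrow> u \<in> Fn n \<and> v \<in> Fn n \<and> (u = [] \<or> v = [] \<or> hd v \<noteq> inv_letter (last u))"
  by (auto simp: Fn_def reduced_append)

lemma inverse_w_in_Fn [simp]: "inverse_w w \<in> Fn n \<longleftrightarrow> w \<in> Fn n"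
  by (auto simp: Fn_def set_inverse_w)

lemma mult_in_Fn':
  assumes "v \<in> Fn n" "\<forall>x\<in>set u. fst x < n"
  shows "mult u v \<in> Fn n"
proof -
  have "set (cons_red x w) \<subseteq> insert x (set w)" for x w
    by (cases w) auto
  then have "set (mult u v) \<subseteq> set u \<union> set v"
    by (induction u) (simp, force simp: mult_Cons)
  then show ?thesis using assms by (auto simp: Fn_def reduced_mult)
qed

lemma mult_in_Fn: "u \<in> Fn n \<Longrightarrow> v \<in> Fn n \<Longrightarrow> mult u v \<in> Fn n"
  by (rule mult_in_Fn') (auto simp: Fn_def)

lemma finite_Fn_length_le: "finite {w \<in> Fn n. length w \<le> L}"
proof (rule finite_subset)
  show "{w \<in> Fn n. length w \<le> L} \<subseteq> {w. set w \<subseteq> {..<n} \<times> UNIV \<and> length w \<le> L}"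
    by (auto simp: Fn_def)
qed (simp add: finite_lists_length_le)

lemma take_in_Fn: "w \<in> Fn n \<Longrightarrow> take i w \<in> Fn n"
  using Fn_append[of "take i w" "drop i w" n] by simp

section \<open>Endomorphisms given by the images of the basis\<close>

lemma img_letter_inv_letter: "img_letter f (inv_letter x) = inverse_w (img_letter f x)"
  by (simp add: img_letter_def)

lemma hom_Nil [simp]: "hom f [] = []"
  by (simp add: hom_def)

lemma hom_Cons: "hom f (x # w) = mult (img_letter f x) (hom f w)"
  by (simp add: hom_def)

locale endo =
  fixes n :: nat and f :: "nat \<Rightarrow> word"
  assumes f_in_Fn: "j < n \<Longrightarrow> f j \<in> Fn n"
begin

lemma img_letter_in_Fn: "fst x < n \<Longrightarrow> img_letter f x \<in> Fn n"
  by (simp add: img_letter_def f_in_Fn)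

lemma hom_in_Fn: "\<forall>x\<in>set w. fst x < n \<Longrightarrow> hom f w \<in> Fn n"
  by (induction w) (auto simp: hom_Cons intro!: mult_in_Fn img_letter_in_Fn)

subsection \<open>The twisted conjugacy graph\<close>

text \<open>Here \<open>run c g\<close> is \<open>c \<cdot> g\<close>, and the pair \<open>(c, j)\<close> encodes the edge from \<open>c\<close> to \<open>c \<cdot> x\<^sub>j\<close>.\<close>

definition step :: "word \<Rightarrow> letter \<Rightarrow> word" where
  "step c x = cons_red (inv_letter x) (mult c (img_letter f x))"

definition run :: "word \<Rightarrow> word \<Rightarrow> word" where
  "run c w = foldl step c w"

text \<open>This is the edge by which the letter \<open>x\<close> leaves \<open>c\<close>. An
  inverse letter runs backwards along an edge with origin \<open>step c x\<close>, so both
  directions of travel give the same code.\<close>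

definition edge :: "word \<Rightarrow> letter \<Rightarrow> word \<times> nat" where
  "edge c x = (if snd x then c else step c x, fst x)"

abbreviation tgt :: "word \<times> nat \<Rightarrow> word" where
  "tgt e \<equiv> step (fst e) (snd e, True)"

text \<open>For \<open>c = x # t\<close> this is the product of \<open>t\<close> and \<phi>(x). The
  value at \<open>[]\<close> is meaningless, so the vertex 1 is excluded wherever choices are
  counted.\<close>

definition flow :: "word \<Rightarrow> word" where
  "flow c = step c (hd c)"

lemma step_in_Fn:
  assumes "c \<in> Fn n" "fst x < n"
  shows "step c x \<in> Fn n"
  using mult_in_Fn'[of "mult c (img_letter f x)" n "[inv_letter x]"] assms
  by (auto simp: step_def mult_Cons intro!: mult_in_Fn img_letter_in_Fn)

lemma step_inv:
  assumes "c \<in> Fn n" "fst x < n"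
  shows "step (step c x) (inv_letter x) = c"
proof -
  let ?y = "img_letter f x"
  have r: "reduced c" "reduced ?y" using assms by (auto intro!: FnD(1)[of _ n] img_letter_in_Fn)
  have "step (step c x) (inv_letter x) =
      cons_red x (mult (cons_red (inv_letter x) (mult c ?y)) (inverse_w ?y))"
    by (simp add: step_def img_letter_inv_letter)
  also have "\<dots> = cons_red x (cons_red (inv_letter x) (mult (mult c ?y) (inverse_w ?y)))"
    using r by (simp add: mult_cons_red)
  also have "mult (mult c ?y) (inverse_w ?y) = c"
    using r by (simp add: mult_assoc mult_inverse_right mult_Nil2)
  also have "cons_red x (cons_red (inv_letter x) c) = c"
    using cons_red_inv_cancel[OF r(1), of "inv_letter x"] by simp
  finally show ?thesis .
qed

lemma edge_inv: "c \<in> Fn n \<Longrightarrow> fst x < n \<Longrightarrow> edge (step c x) (inv_letter x) = edge c x"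
  by (auto simp: edge_def step_inv)

lemma run_Nil [simp]: "run c [] = c"
  by (simp add: run_def)

lemma run_Cons: "run c (x # w) = run (step c x) w"
  by (simp add: run_def)

lemma run_append: "run c (u @ w) = run (run c u) w"
  by (simp add: run_def)

lemma run_in_Fn: "c \<in> Fn n \<Longrightarrow> \<forall>x\<in>set w. fst x < n \<Longrightarrow> run c w \<in> Fn n"
  by (induction w arbitrary: c) (auto simp: run_Cons step_in_Fn)

lemma run_eq:
  assumes "c \<in> Fn n" "\<forall>x\<in>set w. fst x < n"
  shows "run c w = mult (inverse_w w) (mult c (hom f w))"
  using assms
proof (induction w arbitrary: c)
  case Nil
  then show ?case by (simp add: mult_Nil2 FnD)
next
  case (Cons x w)
  let ?y = "img_letter f x"
  have r: "reduced c" "reduced ?y" "reduced (hom f w)"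
    using Cons.prems by (auto intro!: FnD(1)[of _ n] img_letter_in_Fn hom_in_Fn)
  have "run c (x # w) = mult (inverse_w w) (mult (step c x) (hom f w))"
    using Cons by (simp add: run_Cons step_in_Fn)
  also have "mult (step c x) (hom f w) = cons_red (inv_letter x) (mult c (mult ?y (hom f w)))"
    using r by (simp add: step_def mult_cons_red mult_assoc)
  finally show ?case
    by (simp add: inverse_w_Cons mult_append mult_Cons hom_Cons)
qed

text \<open>Signed number of passages through \<open>e\<close> on the path from \<open>c\<close>
  that spells the word. On the stabilizer of a vertex it becomes a homomorphism to the
  integers.\<close>

fun cross :: "word \<times> nat \<Rightarrow> word \<Rightarrow> word \<Rightarrow> int" where
  "cross e c [] = 0"
| "cross e c (x # w) = (if edge c x = e then if snd x then 1 else -1 else 0) + cross e (step c x) w"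

lemma cross_append: "cross e c (u @ w) = cross e c u + cross e (run c u) w"
  by (induction u arbitrary: c) (auto simp: run_Cons)

text \<open>A backtracking passes one edge in both directions and ends where it began, so free
  reduction changes neither the signed count nor the endpoint.\<close>

lemma cons_red_cross_run:
  assumes "c \<in> Fn n" "fst x < n" "reduced v"
  shows "cross e c (cons_red x v) = cross e c (x # v)" "run c (cons_red x v) = run c (x # v)"
  using assms by (cases v; auto simp: edge_inv step_inv run_Cons)+

lemma mult_cross_run:
  assumes "c \<in> Fn n" "\<forall>x\<in>set u. fst x < n" "reduced v"
  shows "cross e c (mult u v) = cross e c u + cross e (run c u) v"
    "run c (mult u v) = run (run c u) v"
  using assms
  by (induction u arbitrary: c)
     (auto simp: mult_Cons cons_red_cross_run reduced_mult run_Cons step_in_Fn)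

lemma run_inverse_w:
  assumes "c \<in> Fn n" "w \<in> Fn n"
  shows "run (run c w) (inverse_w w) = c"
  using mult_cross_run(2)[of c w "inverse_w w"] assms
  by (simp add: mult_inverse_right FnD)

lemma cross_inverse_w:
  assumes "c \<in> Fn n" "w \<in> Fn n"
  shows "cross e (run c w) (inverse_w w) = - cross e c w"
  using mult_cross_run(1)[of c w "inverse_w w" e] assms
  by (simp add: mult_inverse_right FnD)

lemma hom_eq_mult_run:
  assumes "c \<in> Fn n" "w \<in> Fn n"
  shows "mult c (hom f w) = mult w (run c w)"
proof -
  have "hom f w \<in> Fn n" using assms by (intro hom_in_Fn) (auto dest: FnD)
  then have "reduced (mult c (hom f w))" by (auto intro: reduced_mult FnD)
  then show ?thesis
    using assms run_eq[of c w] by (simp add: mult_inverse_cancel' FnD)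
qed

text \<open>This links the graph to the endomorphism: fixed elements are the loops at
  \<open>c\<close>, and for other words the vertex reached determines what follows \<open>w\<close>
  in its image.\<close>

lemma hom_conj_endo:
  assumes "c \<in> Fn n" "w \<in> Fn n"
  shows "hom (conj_endo c f) w = mult w (mult (run c w) (inverse_w c))"
proof -
  have c: "reduced c" using assms FnD by auto
  have img: "img_letter (conj_endo c f) x = mult c (mult (img_letter f x) (inverse_w c))"
    if "fst x < n" for x
    using FnD(1)[OF f_in_Fn[OF that]] c
    by (simp add: img_letter_def conj_endo_def inverse_w_mult reduced_mult mult_assoc)
  have "hom (conj_endo c f) w = mult c (mult (hom f w) (inverse_w c))"
    if "\<forall>x\<in>set w. fst x < n" for w
    using that
  proof (induction w)
    case Nil
    then show ?case using c by (simp add: mult_inverse_right)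
  next
    case (Cons x w)
    have r: "reduced (img_letter f x)" "reduced (hom f w)"
      using Cons.prems by (auto intro!: FnD(1)[of _ n] img_letter_in_Fn hom_in_Fn)
    then show ?case
      using Cons c by (simp add: hom_Cons img mult_assoc reduced_mult mult_inverse_cancel)
  qed
  then have "hom (conj_endo c f) w = mult (mult c (hom f w)) (inverse_w c)"
    using assms c by (simp add: mult_assoc FnD)
  also have "\<dots> = mult w (mult (run c w) (inverse_w c))"
    using assms c by (simp add: hom_eq_mult_run mult_assoc)
  finally show ?thesis .
qed

lemma Fix_conj_endo:
  assumes "c \<in> Fn n"
  shows "Fix n (conj_endo c f) = {w \<in> Fn n. run c w = c}"
proof -
  have "hom (conj_endo c f) w = w \<longleftrightarrow> run c w = c" if w: "w \<in> Fn n" for w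
  proof
    have r: "reduced w" "reduced c" "reduced (run c w)"
      using w assms run_in_Fn[of c w] FnD by auto
    assume "run c w = c"
    then show "hom (conj_endo c f) w = w"
      using w assms r by (simp add: hom_conj_endo mult_inverse_right mult_Nil2)
  next
    have r: "reduced w" "reduced c" "reduced (run c w)"
      using w assms run_in_Fn[of c w] FnD by auto
    assume "hom (conj_endo c f) w = w"
    then have "mult w (mult (run c w) (inverse_w c)) = w"
      using w assms by (simp add: hom_conj_endo)
    then have "mult (run c w) (inverse_w c) = []"
      using mult_inverse_cancel[of "mult (run c w) (inverse_w c)" w] r
      by (simp add: reduced_mult mult_inverse_left)
    then have "mult (mult (run c w) (inverse_w c)) c = c" by simp
    then show "run c w = c"
      using r by (simp add: mult_assoc mult_inverse_left mult_Nil2)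
  qed
  then show ?thesis by (auto simp: Fix_def)
qed

end

lemma expsum_eq:
  "expsum j w = int (card {i. i < length w \<and> w ! i = (j, True)})
              - int (card {i. i < length w \<and> w ! i = (j, False)})"
proof -
  let ?h = "\<lambda>x::letter. of_bool (x = (j, True)) - of_bool (x = (j, False)) :: int"
  have "(\<lambda>x::letter. if fst x = j then (if snd x then 1 else -1) else 0) = ?h"
    by (auto simp: fun_eq_iff)
  then have "expsum j w = (\<Sum>i<length w. ?h (w ! i))"
    by (simp add: expsum_def sum_list_sum_nth atLeast0LessThan)
  also have "\<dots> = int (card ({..<length w} \<inter> {i. w ! i = (j, True)}))
               - int (card ({..<length w} \<inter> {i. w ! i = (j, False)}))"
    by (simp only: sum_subtractf sum_of_bool_eq finite_lessThan)
  finally show ?thesis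
    by (simp add: Int_def)
qed

context endo
begin

subsection \<open>The index of a component\<close>

definition chosen_src :: "word \<times> nat \<Rightarrow> bool" where
  "chosen_src e \<longleftrightarrow> fst e \<noteq> [] \<and> hd (fst e) = (snd e, True)"

definition chosen_tgt :: "word \<times> nat \<Rightarrow> bool" where
  "chosen_tgt e \<longleftrightarrow> tgt e \<noteq> [] \<and> hd (tgt e) = (snd e, False)"

definition unchosen :: "(word \<times> nat) set" where
  "unchosen = {e \<in> Fn n \<times> {..<n}. \<not> chosen_src e \<and> \<not> chosen_tgt e}"

definition twice_chosen :: "(word \<times> nat) set" where
  "twice_chosen = {e \<in> Fn n \<times> {..<n}. chosen_src e \<and> chosen_tgt e}"

text \<open>The target fails to begin with the inverse of \<open>x\<^sub>j\<close> only if the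
  product of \<open>c\<close> and \<open>f j\<close> begins with \<open>x\<^sub>j\<close>. Since
  \<open>c\<close> does not begin with it, all of \<open>c\<close> must cancel against the part of
  \<open>f j\<close> before an occurrence of \<open>x\<^sub>j\<close>.\<close>

lemma unchosen_iff:
  assumes "j < n"
  shows "(c, j) \<in> unchosen \<longleftrightarrow> (\<exists>v. f j = inverse_w c @ (j, True) # v)"
proof
  assume "(c, j) \<in> unchosen"
  then have c: "reduced c" "c = [] \<or> hd c \<noteq> (j, True)"
    and d: "\<not> chosen_tgt (c, j)" by (auto simp: unchosen_def chosen_src_def FnD)
  obtain c' r s' where *: "c = c' @ r" "f j = inverse_w r @ s'" "mult c (f j) = c' @ s'"
    using mult_decomp[OF c(1)] by blast
  have "c' @ s' \<noteq> []" "hd (c' @ s') = (j, True)"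
    using d * by (cases "c' @ s'"; auto simp: chosen_tgt_def step_def img_letter_def inv_letter_def
      split: if_splits)+
  with c * have "c' = []" "s' = (j, True) # tl s'" by (cases c'; cases s'; auto)+
  with * show "\<exists>v. f j = inverse_w c @ (j, True) # v" by force
next
  assume "\<exists>v. f j = inverse_w c @ (j, True) # v"
  then obtain v where v: "f j = inverse_w c @ (j, True) # v" ..
  have F: "inverse_w c @ (j, True) # v \<in> Fn n" using f_in_Fn[OF assms] v by simp
  then have c: "c \<in> Fn n" "c = [] \<or> hd c \<noteq> (j, True)" "v = [] \<or> hd v \<noteq> (j, False)"
    "reduced ((j, True) # v)"
    using FnD(1)[OF F]
    by (auto simp: Fn_append Fn_Cons last_inverse_w reduced_append inv_letter_def)
  then have "mult c (f j) = (j, True) # v"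
    using v mult_inverse_cancel'[of "(j, True) # v" "c"] 
      mult_eq_append[of "inverse_w c" "(j, True) # v"] FnD(1)[OF F] by simp
  then have "tgt (c, j) = v" by (simp add: step_def img_letter_def inv_letter_def)
  with c assms show "(c, j) \<in> unchosen"
    by (auto simp: unchosen_def chosen_src_def chosen_tgt_def)
qed

text \<open>For \<open>c = (j, True) # c'\<close> the target is the product of \<open>c'\<close> and
  \<open>f j\<close>. As \<open>c\<close> is reduced, \<open>c'\<close> does not begin with
  \<open>(j, False)\<close>; a target that does forces \<open>c'\<close> to cancel
  completely.\<close>

lemma twice_chosen_iff:
  assumes "j < n"
  shows "(c, j) \<in> twice_chosen \<longleftrightarrow> (\<exists>c' v. c = (j, True) # c' \<and> f j = inverse_w c' @ (j, False) # v)"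
proof
  assume "(c, j) \<in> twice_chosen"
  then obtain c' where c: "c = (j, True) # c'" "reduced ((j, True) # c')"
    and d: "chosen_tgt (c, j)"
    by (cases c) (auto simp: twice_chosen_def chosen_src_def FnD)
  have rf: "reduced (mult c' (f j))"
    using f_in_Fn[OF assms] by (auto intro: reduced_mult FnD)
  have m: "tgt (c, j) = mult c' (f j)"
    using cons_red_inv_cancel[OF rf, of "(j, True)"] c by (simp add: step_def img_letter_def mult_Cons)
  have c': "reduced c'" "c' = [] \<or> hd c' \<noteq> (j, False)" using c by (auto simp: reduced_Cons inv_letter_def)
  obtain a r s' where *: "c' = a @ r" "f j = inverse_w r @ s'" "mult c' (f j) = a @ s'"
    using mult_decomp[OF c'(1)] by blast
  have "a @ s' \<noteq> []" "hd (a @ s') = (j, False)"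
    using d m * by (auto simp: chosen_tgt_def)
  with c' * have "a = []" "s' = (j, False) # tl s'" by (cases a; cases s'; auto)+
  with * c show "\<exists>c' v. c = (j, True) # c' \<and> f j = inverse_w c' @ (j, False) # v" by force
next
  assume "\<exists>c' v. c = (j, True) # c' \<and> f j = inverse_w c' @ (j, False) # v"
  then obtain c' v where v: "c = (j, True) # c'" "f j = inverse_w c' @ (j, False) # v" by blast
  have F: "inverse_w c' @ (j, False) # v \<in> Fn n" using f_in_Fn[OF assms] v by simp
  then have c: "c \<in> Fn n" "reduced ((j, False) # v)"
    using assms v FnD(1)[OF F]
    by (auto simp: Fn_append Fn_Cons last_inverse_w reduced_append inv_letter_def)
  then have "mult c' (f j) = (j, False) # v"
    using v mult_inverse_cancel'[of "(j, False) # v" "c'"] 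
      mult_eq_append[of "inverse_w c'" "(j, False) # v"] FnD(1)[OF F] by simp
  then have "tgt (c, j) = (j, False) # v"
    using v cons_red_inv_cancel[OF c(2), of "(j, True)"]
    by (simp add: step_def img_letter_def mult_Cons)
  with c v assms show "(c, j) \<in> twice_chosen"
    by (auto simp: twice_chosen_def chosen_src_def chosen_tgt_def)
qed

lemma occurrences_inj_on: "inj_on (\<lambda>i. inverse_w (take i w)) {i. i < length w \<and> P i}"
  by (rule inj_on_inverseI[of _ length]) simp

lemma unchosen_eq:
  assumes "j < n"
  shows "{c. (c, j) \<in> unchosen}
    = (\<lambda>i. inverse_w (take i (f j))) ` {i. i < length (f j) \<and> f j ! i = (j, True)}"
proof (intro set_eqI iffI)
  fix c assume "c \<in> {c. (c, j) \<in> unchosen}"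
  then obtain v where "f j = inverse_w c @ (j, True) # v" using unchosen_iff assms by auto
  then show "c \<in> (\<lambda>i. inverse_w (take i (f j))) ` {i. i < length (f j) \<and> f j ! i = (j, True)}"
    by (intro image_eqI[of _ _ "length c"]) (auto simp: nth_append)
next
  fix c assume "c \<in> (\<lambda>i. inverse_w (take i (f j))) ` {i. i < length (f j) \<and> f j ! i = (j, True)}"
  then obtain i where i: "c = inverse_w (take i (f j))" "i < length (f j)" "f j ! i = (j, True)"
    by auto
  then have "f j = inverse_w c @ (j, True) # drop (Suc i) (f j)"
    using id_take_nth_drop[of i "f j"] by simp
  then show "c \<in> {c. (c, j) \<in> unchosen}" using unchosen_iff assms by blast
qed

lemma twice_chosen_eq:
  assumes "j < n"
  shows "{c. (c, j) \<in> twice_chosen} = (\<lambda>c. (j, True) # c) `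
    (\<lambda>i. inverse_w (take i (f j))) ` {i. i < length (f j) \<and> f j ! i = (j, False)}"
proof (intro set_eqI iffI)
  fix c assume "c \<in> {c. (c, j) \<in> twice_chosen}"
  then obtain c' v where "c = (j, True) # c'" "f j = inverse_w c' @ (j, False) # v"
    using twice_chosen_iff assms by auto
  then show "c \<in> (\<lambda>c. (j, True) # c) `
    (\<lambda>i. inverse_w (take i (f j))) ` {i. i < length (f j) \<and> f j ! i = (j, False)}"
    by (intro image_eqI[of _ _ "c'"] image_eqI[of _ _ "length c'"]) (auto simp: nth_append)
next
  fix c assume "c \<in> (\<lambda>c. (j, True) # c) `
    (\<lambda>i. inverse_w (take i (f j))) ` {i. i < length (f j) \<and> f j ! i = (j, False)}"
  then obtain i where i: "c = (j, True) # inverse_w (take i (f j))" "i < length (f j)"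
    "f j ! i = (j, False)"
    by auto
  then have "f j = inverse_w (inverse_w (take i (f j))) @ (j, False) # drop (Suc i) (f j)"
    using id_take_nth_drop[of i "f j"] by simp
  then show "c \<in> {c. (c, j) \<in> twice_chosen}" using twice_chosen_iff i(1) assms by blast
qed

lemma finite_unchosen: "finite unchosen"
  and finite_twice_chosen: "finite twice_chosen"
  and trace_ab_eq: "trace_ab n f = int (card unchosen) - int (card twice_chosen)"
proof -
  \<comment> \<open>Swapping the pairs turns the set into a disjoint union over \<open>j\<close>,
    whose cardinality is a sum.\<close>
  have U: "unchosen = (\<lambda>(j, c). (c, j)) ` (SIGMA j:{..<n}. {c. (c, j) \<in> unchosen})"
    by (force simp: unchosen_def)
  have D: "twice_chosen = (\<lambda>(j, c). (c, j)) ` (SIGMA j:{..<n}. {c. (c, j) \<in> twice_chosen})"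
    by (force simp: twice_chosen_def)
  have inj: "inj_on (\<lambda>(j, c). (c, j)) A" for A :: "(nat \<times> word) set"
    by (auto simp: inj_on_def)
  have fU: "finite {c. (c, j) \<in> unchosen}" and fD: "finite {c. (c, j) \<in> twice_chosen}"
    if "j < n" for j
    using that by (simp_all add: unchosen_eq twice_chosen_eq)
  show "finite unchosen" by (subst U) (auto intro!: finite_SigmaI fU)
  show "finite twice_chosen" by (subst D) (auto intro!: finite_SigmaI fD)
  have "card {c. (c, j) \<in> unchosen} = card {i. i < length (f j) \<and> f j ! i = (j, True)}"
    "card {c. (c, j) \<in> twice_chosen} = card {i. i < length (f j) \<and> f j ! i = (j, False)}"
    if "j < n" for j
    using that by (simp_all add: unchosen_eq twice_chosen_eq card_image occurrences_inj_on)
  then have "trace_ab n f = (\<Sum>j<n. int (card {c. (c, j) \<in> unchosen}) - int (card {c. (c, j) \<in> twice_chosen}))"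
    unfolding trace_ab_def by (intro sum.cong) (auto simp: expsum_eq)
  also have "\<dots> = int (card (SIGMA j:{..<n}. {c. (c, j) \<in> unchosen}))
      - int (card (SIGMA j:{..<n}. {c. (c, j) \<in> twice_chosen}))"
    using fU fD by (simp add: sum_subtractf card_SigmaI)
  also have "\<dots> = int (card unchosen) - int (card twice_chosen)"
    by (subst (2) U, subst (2) D) (simp only: card_image[OF inj])
  finally show "trace_ab n f = int (card unchosen) - int (card twice_chosen)" .
qed

section \<open>Components of the graph and the sum of their indices\<close>

definition component :: "word \<Rightarrow> word set" where
  "component c = run c ` Fn n"

lemma component_subset: "c \<in> Fn n \<Longrightarrow> component c \<subseteq> Fn n"
  by (auto simp: component_def intro!: run_in_Fn dest: FnD)

lemma component_refl: "c \<in> component c"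
  by (auto simp: component_def intro!: image_eqI[of _ _ "[]"])

lemma component_run:
  assumes "c \<in> Fn n" "d \<in> component c" "\<forall>x\<in>set w. fst x < n"
  shows "run d w \<in> component c"
proof -
  obtain g where g: "g \<in> Fn n" "d = run c g" using assms by (auto simp: component_def)
  \<comment> \<open>The word \<open>g @ w\<close> need not be reduced; multiplying it by the empty
    word reduces it.\<close>
  have "run d w = run c (mult (g @ w) [])"
    using mult_cross_run(2)[of c "g @ w" "[]"] assms g Fn_letters[OF g(1)]
    by (simp add: run_append ball_Un)
  moreover have "mult (g @ w) [] \<in> Fn n"
    using assms g by (intro mult_in_Fn') (auto dest: FnD)
  ultimately show ?thesis by (auto simp: component_def)
qed

lemma component_step: "c \<in> Fn n \<Longrightarrow> d \<in> component c \<Longrightarrow> fst x < n \<Longrightarrow> step d x \<in> component c"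
  using component_run[of c d "[x]"] by (simp add: run_Cons)

lemma component_eq_iff:
  assumes "c \<in> Fn n" "d \<in> Fn n"
  shows "component d = component c \<longleftrightarrow> d \<in> component c"
proof
  assume d: "d \<in> component c"
  then obtain g where g: "g \<in> Fn n" "d = run c g" by (auto simp: component_def)
  then have "c = run d (inverse_w g)" using run_inverse_w assms by simp
  then have "c \<in> component d"
    using component_run[OF assms(2) component_refl, of "inverse_w g"] g
      Fn_letters[of "inverse_w g" n] by simp
  then show "component d = component c"
    using component_run[OF assms(1) d] component_run[OF assms(2)] Fn_letters
    unfolding component_def[of d] component_def[of c] by blast
qed (use component_refl in auto)

definition index :: "word set \<Rightarrow> int" where
  "index K = of_bool ([] \<in> K) + int (card {e \<in> twice_chosen. fst e \<in> K})
                              - int (card {e \<in> unchosen. fst e \<in> K})"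

text \<open>Only the component of the vertex 1 and those with an exceptional edge can have nonzero
  index, and each exceptional place lies in exactly one member of this finite family.\<close>

lemma sum_index:
  obtains C where "finite C" "C \<subseteq> component ` Fn n" "sum index C = 1 - trace_ab n f"
proof -
  define C where "C = component ` insert [] (fst ` unchosen \<union> fst ` twice_chosen)"
  have fin: "finite C" by (simp add: C_def finite_unchosen finite_twice_chosen)
  have sub: "unchosen \<subseteq> Fn n \<times> UNIV" "twice_chosen \<subseteq> Fn n \<times> UNIV"
    by (auto simp: unchosen_def twice_chosen_def)
  then have C: "C \<subseteq> component ` Fn n" by (force simp: C_def)
  have iff: "d \<in> K \<longleftrightarrow> component d = K" if "K \<in> C" "d \<in> Fn n" for d K
    using that C component_eq_iff by auto
  have count: "(\<Sum>K\<in>C. int (card {e \<in> S. fst e \<in> K})) = int (card S)"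
    if "S = unchosen \<or> S = twice_chosen" for S
  proof -
    have S: "finite S" "(component \<circ> fst) ` S \<subseteq> C" "fst ` S \<subseteq> Fn n"
      using that sub finite_unchosen finite_twice_chosen by (auto simp: C_def)
    have "(\<Sum>K\<in>C. int (card {e \<in> S. fst e \<in> K})) = (\<Sum>K\<in>C. \<Sum>e\<in>{e \<in> S. (component \<circ> fst) e = K}. 1)"
      using S by (intro sum.cong) (auto simp: iff intro!: arg_cong[of _ _ card])
    also have "\<dots> = int (card S)"
      by (subst sum.group[OF S(1) fin S(2)]) simp
    finally show ?thesis .
  qed
  have "(\<Sum>K\<in>C. of_bool ([] \<in> K) :: int) = (\<Sum>K\<in>C. of_bool (K = component []))"
    by (intro sum.cong) (auto simp: iff)
  also have "\<dots> = 1"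
    using fin by (subst sum_of_bool_eq) (auto simp: C_def)
  finally have "sum index C = 1 - trace_ab n f"
    by (simp add: index_def sum.distrib sum_subtractf count trace_ab_eq)
  with that fin C show ?thesis by blast
qed

lemma index_ge_1:
  assumes "trace_ab n f < 1"
  obtains c where "c \<in> Fn n" "index (component c) \<ge> 1"
proof -
  obtain C where C: "finite C" "C \<subseteq> component ` Fn n" "sum index C = 1 - trace_ab n f"
    by (rule sum_index)
  then have "\<not> sum index C \<le> 0" using assms by simp
  then obtain K where "K \<in> C" "index K > 0" using sum_nonpos[of C index] by force
  with C that show ?thesis by force
qed

lemma index_le_minus_1:
  assumes "trace_ab n f > 1"
  obtains c where "c \<in> Fn n" "index (component c) \<le> -1"
proof -
  obtain C where C: "finite C" "C \<subseteq> component ` Fn n" "sum index C = 1 - trace_ab n f"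
    by (rule sum_index)
  then have "\<not> sum index C \<ge> 0" using assms by simp
  then obtain K where "K \<in> C" "index K < 0" using sum_nonneg[of C index] by force
  with C that show ?thesis by force
qed

section \<open>Finite induced subgraphs, the flow and the Euler characteristic\<close>

definition edges :: "word set \<Rightarrow> (word \<times> nat) set" where
  "edges V = {e. fst e \<in> V \<and> snd e < n \<and> tgt e \<in> V}"

definition outflow :: "word set \<Rightarrow> word set" where
  "outflow V = {v \<in> V. v \<noteq> [] \<and> flow v \<notin> V}"

lemma finite_edges: "finite V \<Longrightarrow> finite (edges V)"
  by (rule finite_subset[of _ "V \<times> {..<n}"]) (auto simp: edges_def)

lemma flow_in_Fn: "v \<in> Fn n \<Longrightarrow> v \<noteq> [] \<Longrightarrow> flow v \<in> Fn n"
  by (simp add: flow_def step_in_Fn hd_Fn)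

lemma step_chosen_True: "v \<in> Fn n \<Longrightarrow> v \<noteq> [] \<Longrightarrow> \<not> snd (hd v) \<Longrightarrow> step (flow v) (fst (hd v), True) = v"
  using step_inv[of v "hd v"] by (simp add: flow_def inv_letter_def hd_Fn)

lemma step_chosen_False:
  "v \<in> Fn n \<Longrightarrow> chosen_tgt (v, j) \<Longrightarrow> j < n \<Longrightarrow> flow (tgt (v, j)) = v"
  using step_inv[of v "(j, True)"] by (auto simp: flow_def chosen_tgt_def inv_letter_def)

text \<open>The choices made inside \<open>V\<close> are counted by edges. Vertices with a positive
  first letter are origins of the edges they choose, the others are targets; so
  \<open>card ?S + card ?G\<close> counts twice-chosen edges double and omits unchosen ones.\<close>

lemma card_flow:
  assumes "finite V" "V \<subseteq> Fn n"
  shows "int (card {v \<in> V. v \<noteq> [] \<and> flow v \<in> V}) + int (card (unchosen \<inter> edges V))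
       = int (card (edges V)) + int (card (twice_chosen \<inter> edges V))"
proof -
  let ?T = "{v \<in> V. v \<noteq> [] \<and> flow v \<in> V \<and> snd (hd v)}"
  let ?F = "{v \<in> V. v \<noteq> [] \<and> flow v \<in> V \<and> \<not> snd (hd v)}"
  let ?S = "{e \<in> edges V. chosen_src e}" and ?G = "{e \<in> edges V. chosen_tgt e}"
  have hd_lt: "fst (hd v) < n" if "v \<in> V" "v \<noteq> []" for v
    using that assms hd_Fn by blast
  have "bij_betw (\<lambda>v. (v, fst (hd v))) ?T ?S"
  proof (rule bij_betw_byWitness[of _ fst])
    show "(\<lambda>v. (v, fst (hd v))) ` ?T \<subseteq> ?S"
      using hd_lt by (auto simp: edges_def chosen_src_def flow_def) (metis prod.collapse)+
    show "fst ` ?S \<subseteq> ?T"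
      by (auto simp: edges_def chosen_src_def flow_def)
  qed (auto simp: chosen_src_def)
  then have 1: "card ?T = card ?S" by (rule bij_betw_same_card)
  \<comment> \<open>A negative first letter runs backwards along the chosen edge, whose origin is
    therefore \<open>flow v\<close> and whose target is \<open>v\<close>.\<close>
  have "bij_betw (\<lambda>v. (flow v, fst (hd v))) ?F ?G"
  proof (rule bij_betw_byWitness[of _ tgt])
    show "\<forall>v\<in>?F. tgt (flow v, fst (hd v)) = v"
      using assms step_chosen_True by auto
    show "\<forall>e\<in>?G. (flow (tgt e), fst (hd (tgt e))) = e"
      using assms step_chosen_False by (auto simp: edges_def chosen_tgt_def)
    show "(\<lambda>v. (flow v, fst (hd v))) ` ?F \<subseteq> ?G"
      using hd_lt assms step_chosen_True
      by (auto simp: edges_def chosen_tgt_def subset_iff prod_eq_iff)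
    show "tgt ` ?G \<subseteq> ?F"
      using assms step_chosen_False by (auto simp: edges_def chosen_tgt_def)
  qed
  then have 2: "card ?F = card ?G" by (rule bij_betw_same_card)
  have fin: "finite ?T" "finite ?F" "finite ?S" "finite ?G" "finite (unchosen \<inter> edges V)"
    using assms by (auto simp: finite_edges)
  have "{v \<in> V. v \<noteq> [] \<and> flow v \<in> V} = ?T \<union> ?F" by auto
  then have "card {v \<in> V. v \<noteq> [] \<and> flow v \<in> V} = card ?T + card ?F"
    by (simp only:) (rule card_Un_disjoint; use fin in auto)
  moreover have "card ?S + card ?G = card (?S \<union> ?G) + card (?S \<inter> ?G)"
    using fin by (intro card_Un_Int) auto
  moreover have "card (?S \<inter> ?G) = card (twice_chosen \<inter> edges V)"
    using assms by (intro arg_cong[of _ _ card]) (auto simp: twice_chosen_def edges_def)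
  moreover have "card (edges V) = card (?S \<union> ?G) + card (unchosen \<inter> edges V)"
    using fin assms
    by (subst card_Un_disjoint[symmetric]) (auto simp: unchosen_def edges_def intro!: arg_cong[of _ _ card])
  ultimately show ?thesis using 1 2 by linarith
qed

definition full :: "word \<Rightarrow> word set \<Rightarrow> bool" where
  "full c V \<longleftrightarrow> finite V \<and> V \<subseteq> component c \<and> ([] \<in> component c \<longrightarrow> [] \<in> V) \<and>
     (\<forall>e \<in> unchosen \<union> twice_chosen. fst e \<in> component c \<longrightarrow> e \<in> edges V)"

text \<open>\<open>V\<close> splits into the vertex 1 (if present), the vertices whose flow stays in
  \<open>V\<close>, and the outflow. \<open>card_flow\<close> evaluates the second class, and
  fullness turns its correction terms into those of the index.\<close>

lemma euler:
  assumes "c \<in> Fn n" "full c V"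
  shows "int (card V) - int (card (edges V)) = index (component c) + int (card (outflow V))"
proof -
  have V: "finite V" "V \<subseteq> Fn n" using assms component_subset by (auto simp: full_def)
  have sub: "fst e \<in> component c" if "e \<in> edges V" for e
    using that assms by (auto simp: edges_def full_def)
  have "{e \<in> unchosen. fst e \<in> component c} = unchosen \<inter> edges V"
    "{e \<in> twice_chosen. fst e \<in> component c} = twice_chosen \<inter> edges V"
    using assms sub by (auto simp: full_def)
  moreover have "card V = card (V \<inter> {[]}) + (card {v \<in> V. v \<noteq> [] \<and> flow v \<in> V} + card (outflow V))"
  proof -
    let ?I = "{v \<in> V. v \<noteq> [] \<and> flow v \<in> V}"
    have fin: "finite ?I" "finite (outflow V)" using V by (auto simp: outflow_def)
    have "V = (V \<inter> {[]}) \<union> (?I \<union> outflow V)" by (auto simp: outflow_def)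
    then have "card V = card ((V \<inter> {[]}) \<union> (?I \<union> outflow V))" by simp
    also have "\<dots> = card (V \<inter> {[]}) + card (?I \<union> outflow V)"
      using fin by (intro card_Un_disjoint) (auto simp: outflow_def)
    also have "card (?I \<union> outflow V) = card ?I + card (outflow V)"
      using fin by (intro card_Un_disjoint) (auto simp: outflow_def)
    finally show ?thesis .
  qed
  moreover have "int (card (V \<inter> {[]})) = of_bool ([] \<in> component c)"
    using assms by (auto simp: full_def Int_insert_right)
  ultimately show ?thesis
    using card_flow[OF V] by (simp add: index_def)
qed

end

section \<open>Lower bounds for the rank\<close>

lemma rk_singleton_Nil: "rk n {[]} = 0"
proof -
  have "x = []" if "x \<in> gen {}" for x using that by induction auto
  then have "gen {} = {[]}" by (auto intro: gen_one)
  then have "rk n {[]} \<le> enat (card ({}::word set))"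
    unfolding rk_def by (intro INF_lower) auto
  then show ?thesis by (simp add: zero_enat_def[symmetric])
qed

lemma rk_ge_1:
  assumes "g \<in> H" "g \<noteq> []"
  shows "rk n H \<ge> 1"
  unfolding rk_def
proof (rule INF_greatest)
  fix S assume S: "S \<in> {S. finite S \<and> S \<subseteq> Fn n \<and> gen S = H}"
  have "x = []" if "x \<in> gen {}" for x using that by induction auto
  then have "S \<noteq> {}" using S assms by auto
  then have "card S \<ge> 1" using S by (simp add: Suc_leI card_gt_0_iff)
  then show "1 \<le> enat (card S)" by (simp add: one_enat_def)
qed

text \<open>Together \<open>h\<close> and \<open>k\<close> map \<open>H\<close> to pairs of
  integers. On a group with at most one generator all values are multiples of one pair, so (1, 0)
  and (0, 1) cannot both occur.\<close>

lemma rk_ge_2: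
  fixes h k :: "word \<Rightarrow> int"
  assumes h: "\<And>x y. x \<in> H \<Longrightarrow> y \<in> H \<Longrightarrow> h (mult x y) = h x + h y"
      "\<And>x. x \<in> H \<Longrightarrow> h (inverse_w x) = - h x"
    and k: "\<And>x y. x \<in> H \<Longrightarrow> y \<in> H \<Longrightarrow> k (mult x y) = k x + k y"
      "\<And>x. x \<in> H \<Longrightarrow> k (inverse_w x) = - k x"
    and a: "a \<in> H" "h a = 1" "k a = 0" and b: "b \<in> H" "h b = 0" "k b = 1"
  shows "rk n H \<ge> 2"
  unfolding rk_def
proof (rule INF_greatest)
  fix S assume "S \<in> {S. finite S \<and> S \<subseteq> Fn n \<and> gen S = H}"
  then have S: "finite S" "gen S = H" by auto
  have "card S \<ge> 2"
  proof (rule ccontr)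
    assume "\<not> card S \<ge> 2"
    then have "card S = 0 \<or> card S = 1" by auto
    then obtain s where s: "S \<subseteq> {s}" using S
      by (metis card_0_eq card_1_singletonE empty_subsetI subset_refl)
    have h0: "h [] = 0" "k [] = 0"
      using h(1)[of "[]" "[]"] k(1)[of "[]" "[]"] S gen_one by auto
    have "\<exists>m. h x = m * h s \<and> k x = m * k s" if "x \<in> gen S" for x
      using that
    proof induction
      case gen_one
      then show ?case using h0 by (intro exI[of _ 0]) auto
    next
      case (gen_base t)
      then show ?case using s by (intro exI[of _ 1]) auto
    next
      case (gen_mult x y)
      then obtain m m' where "h x = m * h s \<and> k x = m * k s" "h y = m' * h s \<and> k y = m' * k s"
        by blast
      then show ?case using gen_mult.hyps S h k by (intro exI[of _ "m + m'"]) (auto simp: algebra_simps)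
    next
      case (gen_inv x)
      then obtain m where "h x = m * h s \<and> k x = m * k s" by blast
      then show ?case using gen_inv.hyps S h k by (intro exI[of _ "- m"]) auto
    qed
    then obtain m m' where "1 = m * h s" "0 = m * k s" "0 = m' * h s" "1 = m' * k s"
      using S a b by metis
    then show False by (metis mult_eq_0_iff zero_neq_one)
  qed
  then show "2 \<le> enat (card S)" by (metis enat_ord_simps(1) numeral_eq_enat)
qed

context endo
begin

section \<open>Spanning trees\<close>

text \<open>\<open>R\<close> is the edge set of a tree on \<open>V\<close>, and \<open>p v\<close> labels the path in this tree from \<open>c\<close> to \<open>v\<close>.\<close>

inductive tree :: "word \<Rightarrow> word set \<Rightarrow> (word \<times> nat) set \<Rightarrow> (word \<Rightarrow> word) \<Rightarrow> bool" for c where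
  base: "tree c {c} {} (\<lambda>_. [])"
| extend: "tree c V R p \<Longrightarrow> v \<in> V \<Longrightarrow> fst x < n \<Longrightarrow> step v x \<notin> V \<Longrightarrow>
    tree c (insert (step v x) V) (insert (edge v x) R) (p(step v x := mult (p v) [x]))"

lemma tgt_edge:
  assumes "v \<in> Fn n" "fst x < n"
  shows "tgt (edge v x) = (if snd x then step v x else v)"
  using step_inv[OF assms] by (cases x) (auto simp: edge_def inv_letter_def)

text \<open>Two of these invariants carry the later arguments: the tree path \<open>p v\<close> has
  signed count 0 at every edge outside \<open>R\<close>, and along each tree edge \<open>p\<close>
  changes by the letter of that edge.\<close>

lemma tree_props:
  assumes "tree c V R p" and c: "c \<in> Fn n"
  shows "finite V \<and> finite R \<and> c \<in> V \<and> V \<subseteq> component c \<and> R \<subseteq> edges V \<and> card V = Suc (card R) \<and>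
    p c = [] \<and>
    (\<forall>v\<in>V. p v \<in> Fn n \<and> run c (p v) = v \<and> (\<forall>e. e \<notin> R \<longrightarrow> cross e c (p v) = 0)) \<and>
    (\<forall>e\<in>R. p (tgt e) = mult (p (fst e)) [(snd e, True)])"
  using assms(1)
proof induction
  case base
  then show ?case by (auto simp: component_refl)
next
  case (extend V R p v x)
  let ?u = "step v x" and ?p = "p(step v x := mult (p v) [x])"
  have v: "v \<in> Fn n" "v \<in> component c" "p v \<in> Fn n" "run c (p v) = v"
    using extend c component_subset by auto
  have u: "?u \<in> component c"
    using component_step c v extend by blast
  have ne: "v \<noteq> ?u" "c \<noteq> ?u" using extend by auto
  have new: "edge v x \<in> edges (insert ?u V)" "edge v x \<notin> edges V"
    using v extend tgt_edge[of v x] by (auto simp: edges_def edge_def)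
  have old: "e \<in> edges (insert ?u V)" "fst e \<noteq> ?u" "tgt e \<noteq> ?u" if "e \<in> R" for e
    using that extend by (auto simp: edges_def)
  have pu: "mult (p v) [x] \<in> Fn n"
    using v extend by (intro mult_in_Fn) (auto simp: Fn_Cons)
  have mcr: "run c (mult (p v) [x]) = ?u"
    "cross e c (mult (p v) [x]) = cross e c (p v) + cross e v [x]" for e
    using mult_cross_run[of c "p v" "[x]"] c v by (auto simp: Fn_letters run_Cons)
  have cr: "cross e c (mult (p v) [x]) = 0" if "e \<notin> insert (edge v x) R" for e
  proof -
    have "cross e c (p v) = 0" using extend that by blast
    then show ?thesis using that by (auto simp: mcr)
  qed
  \<comment> \<open>For an inverse letter \<open>x\<close> the added edge starts at the new vertex,
    so the relation for \<open>p\<close> is read against the direction of the extension.\<close>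
  have undo: "mult (mult (p v) [x]) [inv_letter x] = p v"
    using v by (simp add: mult_assoc mult_Cons mult_Nil2 FnD)
  have pe: "?p (tgt (edge v x)) = mult (?p (fst (edge v x))) [(snd (edge v x), True)]"
    using ne undo tgt_edge[of v x] v extend
    by (cases x) (auto simp: edge_def inv_letter_def)
  have IH: "finite V" "finite R" "c \<in> V" "V \<subseteq> component c" "R \<subseteq> edges V" "card V = Suc (card R)"
    "p c = []"
    and pV: "\<And>w. w \<in> V \<Longrightarrow> p w \<in> Fn n \<and> run c (p w) = w \<and> (\<forall>e. e \<notin> R \<longrightarrow> cross e c (p w) = 0)"
    and pR: "\<And>e. e \<in> R \<Longrightarrow> p (tgt e) = mult (p (fst e)) [(snd e, True)]"
    using extend.IH by blast+
  have "edge v x \<notin> R" using IH new by blast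
  then have "card (insert ?u V) = Suc (card (insert (edge v x) R))"
    using IH extend.hyps by simp
  moreover have "?p w \<in> Fn n \<and> run c (?p w) = w \<and> (\<forall>e. e \<notin> insert (edge v x) R \<longrightarrow> cross e c (?p w) = 0)"
    if "w \<in> insert ?u V" for w
  proof (cases "w = ?u")
    case True
    then show ?thesis using pu mcr(1) cr by simp
  next
    case False
    then show ?thesis using pV[of w] that by simp
  qed
  moreover have "?p (tgt e) = mult (?p (fst e)) [(snd e, True)]" if "e \<in> insert (edge v x) R" for e
  proof (cases "e = edge v x")
    case True
    then show ?thesis using pe by simp
  next
    case False
    then show ?thesis using pR[of e] old[of e] that by simp
  qed
  moreover have "insert (edge v x) R \<subseteq> edges (insert ?u V)"
    using new old by blast
  ultimately show ?case
    using IH u ne by simp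
qed

text \<open>The path is followed from \<open>v\<close>, and an edge is added only where it enters a
  new vertex.\<close>

lemma tree_extend:
  assumes "tree c V R p" "c \<in> Fn n" "v \<in> V" "\<forall>x\<in>set w. fst x < n"
  shows "\<exists>V' R' p'. tree c V' R' p' \<and> V \<subseteq> V' \<and> (\<forall>i. run v (take i w) \<in> V')"
  using assms
proof (induction w arbitrary: v V R p)
  case Nil
  then show ?case by auto
next
  case (Cons x w)
  obtain V1 R1 p1 where 1: "tree c V1 R1 p1" "V \<subseteq> V1" "step v x \<in> V1"
    using Cons.prems extend[of c V R p v x] by (cases "step v x \<in> V") auto
  obtain V' R' p' where "tree c V' R' p'" "V1 \<subseteq> V'" "\<forall>i. run (step v x) (take i w) \<in> V'"
    using Cons.IH[OF 1(1) Cons.prems(2) 1(3)] Cons.prems(4) by auto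
  moreover have "run v (take i (x # w)) \<in> V'" for i
    using calculation 1 Cons.prems(3) by (cases i) (auto simp: run_Cons)
  ultimately show ?case using 1(2) by blast
qed

lemma tree_cover:
  assumes "finite S" "S \<subseteq> component c" "c \<in> Fn n"
  shows "\<exists>V R p. tree c V R p \<and> S \<subseteq> V"
  using assms
proof (induction S)
  case empty
  then show ?case using base by blast
next
  case (insert u S)
  then obtain V R p where t: "tree c V R p" "S \<subseteq> V" by auto
  obtain w where w: "w \<in> Fn n" "u = run c w" using insert.prems by (auto simp: component_def)
  obtain V' R' p' where t': "tree c V' R' p'" "V \<subseteq> V'" "\<forall>i. run c (take i w) \<in> V'"
    using tree_extend[OF t(1) assms(3) _ Fn_letters[OF w(1)], of c] tree_props[OF t(1) assms(3)] by blast
  then have "u \<in> V'" using w(2) by (metis order_refl take_all)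
  with t t' show ?case by blast
qed

lemma full_mono: "full c V \<Longrightarrow> V \<subseteq> V' \<Longrightarrow> V' \<subseteq> component c \<Longrightarrow> finite V' \<Longrightarrow> full c V'"
  by (fastforce simp: full_def edges_def)

lemma ex_full_tree:
  assumes "c \<in> Fn n"
  shows "\<exists>V R p. tree c V R p \<and> full c V"
proof -
  let ?E = "{e \<in> unchosen \<union> twice_chosen. fst e \<in> component c}"
  let ?S = "({[]} \<inter> component c) \<union> fst ` ?E \<union> tgt ` ?E"
  have E: "snd e < n \<and> tgt e \<in> component c" if "e \<in> ?E" for e
    using that component_step[OF assms, of "fst e" "(snd e, True)"]
    by (auto simp: unchosen_def twice_chosen_def)
  have S: "finite ?S" "?S \<subseteq> component c"
    using finite_unchosen finite_twice_chosen E by (simp, blast)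
  obtain V R p where V: "tree c V R p" "?S \<subseteq> V"
    using tree_cover[OF S assms] by (elim exE conjE)
  have "e \<in> edges V" if "e \<in> ?E" for e
  proof -
    have "fst e \<in> ?S" "tgt e \<in> ?S" using that by blast+
    then show ?thesis using E[OF that] V(2) by (auto simp: edges_def)
  qed
  then have "full c V"
    using V(2) tree_props[OF V(1) assms] unfolding full_def by blast
  with V(1) show ?thesis by blast
qed

text \<open>This is the fundamental loop of \<open>e\<close>: along the tree to its origin, across
  \<open>e\<close>, and back along the tree. The tree parts contribute nothing outside
  \<open>R\<close>.\<close>

lemma tree_loop:
  assumes t: "tree c V R p" and c: "c \<in> Fn n" and e: "e \<in> edges V - R"
  obtains g where "g \<in> Fn n" "run c g = c"
    "\<And>e'. e' \<notin> R \<Longrightarrow> cross e' c g = of_bool (e' = e)"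
proof -
  obtain v j where vj: "e = (v, j)" "v \<in> V" "j < n" "step v (j, True) \<in> V"
    using e that[of "fst e" "snd e"] by (auto simp: edges_def)
  let ?u = "step v (j, True)"
  note P = tree_props[OF t c]
  have pv: "p v \<in> Fn n" "run c (p v) = v" "\<And>e. e \<notin> R \<Longrightarrow> cross e c (p v) = 0"
    and pu: "p ?u \<in> Fn n" "run c (p ?u) = ?u" "\<And>e. e \<notin> R \<Longrightarrow> cross e c (p ?u) = 0"
    using P vj by auto
  define q where "q = p v @ [(j, True)]"
  have q: "\<forall>x\<in>set q. fst x < n" "run c q = ?u"
    using Fn_letters[OF pv(1)] vj pv by (auto simp: q_def run_append run_Cons)
  define g where "g = mult q (inverse_w (p ?u))"
  have r: "reduced (inverse_w (p ?u))" using pu FnD by auto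
  have "g \<in> Fn n" unfolding g_def using pu q by (intro mult_in_Fn') auto
  moreover have "run c g = c"
    using mult_cross_run(2)[OF c q(1) r] run_inverse_w[OF c pu(1)] pu q by (simp add: g_def)
  moreover have "cross e' c g = of_bool (e' = e)" if "e' \<notin> R" for e'
    using mult_cross_run(1)[OF c q(1) r, of e'] cross_inverse_w[OF c pu(1), of e'] pu q pv that vj
    by (auto simp: g_def q_def cross_append edge_def)
  ultimately show ?thesis using that by blast
qed

lemma rk_Fix_ge_1:
  assumes "tree c V R p" "c \<in> Fn n" "e \<in> edges V - R"
  shows "rk n (Fix n (conj_endo c f)) \<ge> 1"
proof -
  obtain g where g: "g \<in> Fn n" "run c g = c" "\<And>e'. e' \<notin> R \<Longrightarrow> cross e' c g = of_bool (e' = e)"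
    using tree_loop assms by blast
  have "g \<noteq> []" using g(3)[of e] assms by auto
  with g assms show ?thesis by (intro rk_ge_1[of g]) (auto simp: Fix_conj_endo)
qed

text \<open>The signed crossings of \<open>d\<close> and \<open>e\<close> are homomorphisms on the
  stabilizer, and the two fundamental loops are dual to them.\<close>

lemma rk_Fix_ge_2:
  assumes "tree c V R p" "c \<in> Fn n" "d \<in> edges V - R" "e \<in> edges V - R" "d \<noteq> e"
  shows "rk n (Fix n (conj_endo c f)) \<ge> 2"
proof -
  obtain g where g: "g \<in> Fn n" "run c g = c" "\<And>e'. e' \<notin> R \<Longrightarrow> cross e' c g = of_bool (e' = d)"
    using tree_loop assms(1-3) by blast
  obtain k where k: "k \<in> Fn n" "run c k = c" "\<And>e'. e' \<notin> R \<Longrightarrow> cross e' c k = of_bool (e' = e)"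
    using tree_loop assms(1,2,4) by blast
  have hom: "cross e c (mult x y) = cross e c x + cross e c y" 
    "cross e c (inverse_w x) = - cross e c x"
    if "x \<in> Fix n (conj_endo c f)" "y \<in> Fix n (conj_endo c f)" for x y e
    using that assms(2) mult_cross_run(1)[of c x y e] cross_inverse_w[of c x e]
    by (auto simp: Fix_conj_endo FnD Fn_letters)
  have "g \<in> Fix n (conj_endo c f)" "k \<in> Fix n (conj_endo c f)"
    using g k assms(2) by (simp_all add: Fix_conj_endo)
  moreover have "cross d c g = 1" "cross e c g = 0" "cross d c k = 0" "cross e c k = 1"
    using g(3) k(3) assms by auto
  ultimately show ?thesis
    by (intro rk_ge_2[of _ "cross d c" "cross e c" g k] hom)
qed

text \<open>The Euler characteristic is 1 minus the number of edges outside the tree, but by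
  \<open>euler\<close> at least 1 plus the size of the outflow; so both numbers vanish.\<close>

lemma tree_index_ge_1:
  assumes "tree c V R p" "full c V" and c: "c \<in> Fn n" and i: "index (component c) \<ge> 1"
  shows "edges V = R" "outflow V = {}"
proof -
  note P = tree_props[OF assms(1) c]
  have fin: "finite (edges V)" "finite (outflow V)" using P finite_edges by (auto simp: outflow_def)
  have "card R \<le> card (edges V)" using P fin by (auto intro: card_mono)
  then have "card (edges V) = card R \<and> card (outflow V) = 0"
    using euler[OF c assms(2)] P i by linarith
  then show "edges V = R" "outflow V = {}"
    using P fin card_subset_eq[of "edges V" R] by auto
qed

text \<open>A loop at \<open>c\<close> is enclosed in a full tree that has no further edges. Along
  the loop, \<open>p\<close> then reproduces the reduced word spelled so far, and at the end this is
  \<open>p c\<close>, the empty word.\<close>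

lemma Fix_trivial:
  assumes c: "c \<in> Fn n" and i: "index (component c) \<ge> 1"
  shows "Fix n (conj_endo c f) = {[]}"
proof -
  have "g = []" if g: "g \<in> Fn n" "run c g = c" for g
  proof -
    obtain V0 R0 p0 where V0: "tree c V0 R0 p0" "full c V0" using ex_full_tree c by blast
    have "c \<in> V0" using tree_props[OF V0(1) c] by blast
    from tree_extend[OF V0(1) c this Fn_letters[OF g(1)]]
    obtain V R p where V: "tree c V R p" "V0 \<subseteq> V" "\<forall>i. run c (take i g) \<in> V"
      by blast
    note P = tree_props[OF V(1) c]
    have R: "edges V = R"
      using tree_index_ge_1(1)[OF V(1) full_mono[OF V0(2) V(2)] c i] P by simp
    have "p (run c (take i g)) = take i g" if "i \<le> length g" for i
      using that
    proof (induction i)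
      case 0
      then show ?case using P by simp
    next
      case (Suc i)
      let ?v = "run c (take i g)" and ?x = "g ! i"
      have x: "fst ?x < n" using Suc.prems g(1) by (auto dest: Fn_letters)
      have t: "take (Suc i) g = take i g @ [?x]" using Suc.prems by (simp add: take_Suc_conv_app_nth)
      have v: "?v \<in> V" "step ?v ?x \<in> V" "?v \<in> Fn n"
        using V(3)[rule_format, of "Suc i"] V(3) t P component_subset[OF c]
        by (auto simp: run_append run_Cons)
      have pv: "p ?v = take i g" using Suc by simp
      have E: "edge ?v ?x \<in> R"
        using v x tgt_edge[of ?v ?x] unfolding R[symmetric] by (auto simp: edges_def edge_def)
      have red: "reduced (take i g @ [?x])" using take_in_Fn[OF g(1), of "Suc i"] t by (metis FnD(1))
      have "p (step ?v ?x) = mult (p ?v) [?x]"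
      proof (cases "snd ?x")
        case True
        then show ?thesis using P E tgt_edge[OF v(3) x]
          by (cases ?x) (auto simp: edge_def)
      next
        case False
        \<comment> \<open>The edge points from the next vertex to \<open>?v\<close>, so the tree
          relation has to be solved for the label of the next vertex.\<close>
        then have eq: "p ?v = mult (p (step ?v ?x)) [inv_letter ?x]"
          using P E tgt_edge[OF v(3) x] by (cases ?x) (auto simp: edge_def inv_letter_def)
        have "reduced (p (step ?v ?x))" using P v FnD by blast
        then show ?thesis unfolding eq by (simp add: mult_assoc mult_Cons mult_Nil2)
      qed
      then show ?case using pv red t by (simp add: run_append run_Cons mult_eq_append)
    qed
    from this[of "length g"] g P show ?thesis by simp
  qed
  then show ?thesis using c by (auto simp: Fix_conj_endo)
qed

end

section \<open>Infinite words\<close>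

lemma length_prefix [simp]: "length (prefix i W) = i"
  by (simp add: prefix_def)

lemma nth_prefix [simp]: "k < i \<Longrightarrow> prefix i W ! k = W k"
  by (simp add: prefix_def)

lemma prefix_0 [simp]: "prefix 0 W = []"
  by (simp add: prefix_def)

lemma prefix_Suc: "prefix (Suc i) W = prefix i W @ [W i]"
  by (simp add: prefix_def)

lemma take_prefix: "take i (prefix j W) = prefix (min i j) W"
  by (auto simp: list_eq_iff_nth_eq)

lemma reduced_nth: "reduced w \<longleftrightarrow> (\<forall>i. Suc i < length w \<longrightarrow> w ! Suc i \<noteq> inv_letter (w ! i))"
proof (induction w)
  case (Cons x w)
  show ?case
    unfolding reduced_Cons Cons.IH
    by (cases w) (auto simp: nth_Cons All_less_Suc2 split: nat.splits)
qed simp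

lemma prefix_in_Fn: "W \<in> inf_words n \<Longrightarrow> prefix i W \<in> Fn n"
  by (simp add: inf_words_def Fn_def reduced_nth all_set_conv_all_nth)

lemma le_lcp_len_iff: "L \<le> lcp_len W v \<longleftrightarrow> L \<le> length v \<and> take L v = prefix L W"
proof -
  let ?Q = "\<lambda>k. k = length v \<or> v ! k \<noteq> W k"
  have Q: "?Q (lcp_len W v)"
    unfolding lcp_len_def by (rule LeastI[of ?Q "length v"]) simp
  have min: "\<not> ?Q k" if "k < lcp_len W v" for k
    using that unfolding lcp_len_def by (rule not_less_Least)
  have "L \<le> lcp_len W v \<longleftrightarrow> (\<forall>k<L. \<not> ?Q k)"
  proof
    assume "L \<le> lcp_len W v"
    then show "\<forall>k<L. \<not> ?Q k" using min order_less_le_trans by blast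
  next
    assume "\<forall>k<L. \<not> ?Q k"
    then show "L \<le> lcp_len W v" using Q not_le by blast
  qed
  also have "\<dots> \<longleftrightarrow> L \<le> length v \<and> (\<forall>k<L. v ! k = W k)"
    by (auto simp: not_le[symmetric])
  also have "\<dots> \<longleftrightarrow> L \<le> length v \<and> take L v = prefix L W"
    by (auto simp: list_eq_iff_nth_eq)
  finally show ?thesis .
qed

text \<open>The growth condition for \<open>M = 0\<close> yields the convergence of the images to
  \<open>W\<close>, so attraction becomes a statement about natural numbers.\<close>

lemma attracting_iff:
  "attracting n f W \<longleftrightarrow> W \<in> inf_words n \<and>
     (\<forall>M. \<exists>N. \<forall>j\<ge>N. j + M \<le> lcp_len W (hom f (prefix j W)))"
    (is "_ \<longleftrightarrow> _ \<and> ?R")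
proof -
  let ?g = "\<lambda>i. int (lcp_len W (hom f (prefix i W))) - int i"
  have "filterlim ?g at_top sequentially \<longleftrightarrow> ?R"
  proof
    assume "filterlim ?g at_top sequentially"
    then have "\<exists>N. \<forall>j\<ge>N. int M \<le> ?g j" for M
      by (simp add: filterlim_at_top eventually_sequentially)
    then show ?R by (simp add: le_diff_eq add.commute flip: of_nat_add)
  next
    assume R: ?R
    show "filterlim ?g at_top sequentially"
      unfolding filterlim_at_top eventually_sequentially
    proof
      fix Z
      obtain N where "\<forall>j\<ge>N. j + nat Z \<le> lcp_len W (hom f (prefix j W))" using R by blast
      then have "\<forall>j\<ge>N. Z \<le> ?g j" by force
      then show "\<exists>N. \<forall>j\<ge>N. Z \<le> ?g j" ..
    qed
  qed
  moreover have "converges_to (\<lambda>i. hom f (prefix i W)) W" if R: ?R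
    unfolding converges_to_def
  proof
    fix k
    obtain N where N: "\<forall>j\<ge>N. j + 0 \<le> lcp_len W (hom f (prefix j W))" using R by blast
    have "\<forall>i\<ge>max N k. k \<le> lcp_len W (hom f (prefix i W))" using N by force
    then show "\<exists>N. \<forall>i\<ge>N. k \<le> length (hom f (prefix i W)) \<and> take k (hom f (prefix i W)) = prefix k W"
      unfolding le_lcp_len_iff by blast
  qed
  ultimately show ?thesis
    by (auto simp: attracting_def fixed_inf_def)
qed

text \<open>If \<open>k\<close> letters cancel and \<open>m\<close> letters of \<open>U\<close>
  survive, then \<open>a = m\<close> and \<open>b = k\<close> work. This carries statements about
  tails over to equivalent words.\<close>

lemma inf_mult_prefix:
  assumes U: "U \<in> Fn n" and W: "W \<in> inf_words n"
  shows "inf_mult U W \<in> inf_words n"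
    and "\<exists>a b. \<forall>i. inf_mult U W (a + i) = W (b + i) \<and> prefix (a + i) (inf_mult U W) = mult U (prefix (b + i) W)"
proof -
  let ?P = "\<lambda>k. k \<le> length U \<and> drop (length U - k) U = inverse_w (prefix k W)"
  define k where "k = (GREATEST k. ?P k)"
  define m where "m = length U - k"
  define T where "T = take m U"
  define V where "V = inf_mult U W"
  have k: "?P k"
    unfolding k_def by (rule GreatestI_nat[of ?P 0 "length U"]) auto
  have max: "\<not> ?P (Suc k)"
    using Greatest_le_nat[of ?P "Suc k" "length U"] unfolding k_def[symmetric] by auto
  have V: "V j = (if j < m then U ! j else W (j - m + k))" for j
    by (simp add: V_def inf_mult_def k_def m_def Let_def)
  have tail: "V (m + i) = W (k + i)" for i
    by (simp add: V add.commute)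
  have mU: "m \<le> length U" by (simp add: m_def)
  have UT: "U = T @ inverse_w (prefix k W)"
    using k unfolding T_def m_def by (metis append_take_drop_id)
  have V_inf: "V \<in> inf_words n"
  proof -
    have "fst (V j) < n" for j
      using U W mU Fn_letters[OF U] by (auto simp: V inf_words_def)
    moreover have "V (Suc j) \<noteq> inv_letter (V j)" for j
    proof -
      consider "Suc j < m" | "Suc j = m" | "m \<le> j" by linarith
      then show ?thesis
      proof cases
        case 1
        then show ?thesis using FnD(1)[OF U] mU by (simp add: V reduced_nth)
      next
        case 2
        \<comment> \<open>Here \<open>j\<close> is the last surviving position of \<open>U\<close>;
          if it cancelled too, then \<open>k\<close> would not be maximal.\<close>
        have "W k \<noteq> inv_letter (U ! j)"
        proof
          assume "W k = inv_letter (U ! j)"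
          moreover have "drop j U = U ! j # drop m U"
            using 2 mU Cons_nth_drop_Suc[of j U] by simp
          moreover have "length U - Suc k = j" "Suc k \<le> length U" using 2 k by (auto simp: m_def)
          ultimately have "?P (Suc k)"
            using k by (simp add: prefix_Suc inverse_w_Cons m_def)
          with max show False by blast
        qed
        with 2 show ?thesis by (auto simp: V)
      next
        case 3
        then have "V (Suc j) = W (Suc (j - m + k))" "V j = W (j - m + k)"
          by (auto simp: V Suc_diff_le)
        then show ?thesis using W by (simp add: inf_words_def)
      qed
    qed
    ultimately show ?thesis by (simp add: inf_words_def)
  qed
  then show "inf_mult U W \<in> inf_words n" by (simp add: V_def)
  have "prefix (m + i) V = mult U (prefix (k + i) W)" for i
  proof -
    define Y where "Y = map (\<lambda>j. W (k + j)) [0..<i]"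
    have X: "prefix (k + i) W = prefix k W @ Y"
      by (auto simp: Y_def list_eq_iff_nth_eq nth_append)
    have VT: "prefix (m + i) V = T @ Y"
      using mU by (auto simp: Y_def T_def list_eq_iff_nth_eq nth_append V add.commute)
    have r: "reduced (prefix k W @ Y)" "reduced (T @ Y)" "reduced Y"
      using prefix_in_Fn[OF W, of "k + i"] prefix_in_Fn[OF V_inf, of "m + i"] X VT
      by (auto simp: reduced_append dest: FnD)
    have "mult U (prefix (k + i) W) = mult T (mult (inverse_w (prefix k W)) (mult (prefix k W) Y))"
      using r by (simp add: X mult_eq_append UT[symmetric] flip: mult_append)
    also have "\<dots> = prefix (m + i) V"
      by (simp only: mult_inverse_cancel[OF r(3)] mult_eq_append[OF r(2)] VT)
    finally show ?thesis ..
  qed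
  with tail show "\<exists>a b. \<forall>i. inf_mult U W (a + i) = W (b + i) \<and>
      prefix (a + i) (inf_mult U W) = mult U (prefix (b + i) W)"
    unfolding V_def by blast
qed

lemma inf_mult_Nil [simp]: "inf_mult [] W = W"
proof -
  have "(GREATEST k. k \<le> length ([]::word) \<and> drop (length ([]::word) - k) [] = inverse_w (prefix k W)) = 0"
    by (rule Greatest_equality) auto
  then show ?thesis by (simp add: inf_mult_def)
qed

section \<open>Lower bounds for the number of attracting classes\<close>

lemma a_num_ge_1: "attracting n f W \<Longrightarrow> a_num n f \<ge> 1"
  unfolding a_num_def ecard_def
  by (auto simp: one_enat_def Suc_le_eq card_gt_0_iff quotient_def)

text \<open>The class of a word is its image under \<open>fix_equiv\<close>. That of
  \<open>W'\<close> contains \<open>W'\<close> through the trivial \<open>U\<close>, that of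
  \<open>W\<close> does not, so they differ as sets.\<close>

lemma a_num_ge_2:
  assumes "attracting n f W" "attracting n f W'" "\<And>U. U \<in> Fix n f \<Longrightarrow> inf_mult U W \<noteq> W'"
  shows "a_num n f \<ge> 2"
proof -
  let ?Q = "{W. attracting n f W} // fix_equiv n f"
  let ?c = "\<lambda>W. fix_equiv n f `` {W}"
  have "[] \<in> Fix n f" by (simp add: Fix_def)
  then have "W' \<in> ?c W'" "W' \<notin> ?c W"
    using assms(3) by (force simp: fix_equiv_def)+
  then have "?c W \<noteq> ?c W'" by blast
  moreover have "{?c W, ?c W'} \<subseteq> ?Q" using assms by (auto simp: quotient_def)
  ultimately have "2 \<le> card ?Q" if "finite ?Q"
    using card_mono[OF that, of "{?c W, ?c W'}"] by simp
  then show ?thesis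
    by (auto simp: a_num_def ecard_def numeral_eq_enat)
qed

context endo
begin

section \<open>Attracting words and the flow\<close>

definition ray :: "word \<Rightarrow> infword" where
  "ray v i = hd ((flow ^^ i) v)"

definition infinite_line :: "word \<Rightarrow> bool" where
  "infinite_line v \<longleftrightarrow> v \<in> Fn n \<and> (\<forall>i. (flow ^^ i) v \<noteq> []) \<and> inj (\<lambda>i. (flow ^^ i) v)"

lemma flow_pow_in_Fn: "infinite_line v \<Longrightarrow> (flow ^^ i) v \<in> Fn n"
  by (induction i) (auto simp: infinite_line_def intro: flow_in_Fn)

text \<open>Two consecutive inverse letters would bring the line back to the vertex two steps
  earlier.\<close>

lemma ray_in_inf_words:
  assumes "infinite_line v"
  shows "ray v \<in> inf_words n"
proof -
  have v: "(flow ^^ i) v \<in> Fn n" "(flow ^^ i) v \<noteq> []" for i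
    using flow_pow_in_Fn assms by (auto simp: infinite_line_def)
  have "ray v (Suc i) \<noteq> inv_letter (ray v i)" for i
  proof
    assume "ray v (Suc i) = inv_letter (ray v i)"
    then have "(flow ^^ Suc (Suc i)) v = step (step ((flow ^^ i) v) (ray v i)) (inv_letter (ray v i))"
      by (simp add: flow_def ray_def)
    also have "\<dots> = (flow ^^ i) v"
      using v[of i] by (intro step_inv) (auto simp: ray_def hd_Fn)
    finally have "Suc (Suc i) = i" using assms unfolding infinite_line_def by (metis injD)
    then show False by simp
  qed
  with v show ?thesis by (simp add: inf_words_def ray_def hd_Fn)
qed

lemma run_ray: "run v (prefix i (ray v)) = (flow ^^ i) v"
  by (induction i) (simp_all add: prefix_Suc run_append run_Cons ray_def flow_def[of "(flow ^^ _) v"])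

text \<open>Only finitely many vertices have length at most \<open>L\<close>, and the line visits
  each at most once.\<close>

lemma flow_length_unbounded:
  assumes "infinite_line v"
  shows "\<exists>N. \<forall>i\<ge>N. L \<le> length ((flow ^^ i) v)"
proof -
  have "finite {i. (flow ^^ i) v \<in> {w \<in> Fn n. length w \<le> L}}"
    using finite_vimageI[OF finite_Fn_length_le[of n L], of "\<lambda>i. (flow ^^ i) v"] assms
    by (simp add: infinite_line_def vimage_def)
  then obtain N where "\<forall>i\<in>{i. (flow ^^ i) v \<in> {w \<in> Fn n. length w \<le> L}}. i < N"
    using finite_nat_set_iff_bounded by blast
  then have "L \<le> length ((flow ^^ i) v)" if "i \<ge> N" for i
    using flow_pow_in_Fn[OF assms, of i] that by (metis (mono_tags, lifting) mem_Collect_eq nat_le_linear not_le)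
  then show ?thesis by blast
qed

text \<open>The \<open>Suc\<close> makes the bound strict for images of letters, and positive, so
  that \<open>m \<le> m * img_bound\<close>.\<close>

definition img_bound :: nat where
  "img_bound = Suc (\<Sum>j<n. length (f j))"

text \<open>One step of the flow destroys at most \<open>img_bound\<close> letters at the end of a word, so a long vertex
  on a flow line already spells the letters of the subsequent steps.\<close>

lemma flow_nth:
  assumes v: "v \<in> Fn n" and m: "length v > Suc m * img_bound"
  shows "length (flow v) > m * img_bound" "flow v ! m = v ! Suc m"
proof -
  obtain x t where xt: "v = x # t" using m by (cases v) auto
  let ?y = "img_letter f x"
  have r: "reduced t" "reduced ?y" "fst x < n"
    using v xt by (auto simp: Fn_Cons FnD intro!: FnD(1)[of _ n] img_letter_in_Fn)
  have "length ?y = length (f (fst x))" by (simp add: img_letter_def)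
  also have "\<dots> < img_bound"
    using r(3) member_le_sum[of "fst x" "{..<n}" "\<lambda>j. length (f j)"] by (simp add: img_bound_def)
  finally have l: "m * img_bound < length t - length ?y" using m xt by auto
  have fl: "flow v = mult t ?y"
    using cons_red_inv_cancel[of "mult t ?y" x] r xt
    by (simp add: flow_def step_def mult_Cons reduced_mult)
  have tk: "take (length t - length ?y) (mult t ?y) = take (length t - length ?y) t"
    "length t - length ?y \<le> length (mult t ?y)"
    using take_mult[OF r(1), of "length t - length ?y" ?y] l by auto
  then show "length (flow v) > m * img_bound" using l fl by simp
  have "m < length t - length ?y" using l by (rule le_less_trans[rotated]) (simp add: img_bound_def)
  then show "flow v ! m = v ! Suc m"
    using tk fl xt by (metis nth_Cons_Suc nth_take)
qed

text \<open>Each step moves the letters one place forward, so in a long enough word the letter at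
  place \<open>m\<close> becomes the head after \<open>m\<close> steps.\<close>

lemma nth_flow_pow:
  assumes "infinite_line v" "length ((flow ^^ i) v) > m * img_bound"
  shows "(flow ^^ i) v ! m = ray v (i + m)"
  using assms(2)
proof (induction m arbitrary: i)
  case 0
  then show ?case by (simp add: ray_def hd_conv_nth)
next
  case (Suc m)
  from flow_nth[OF flow_pow_in_Fn[OF assms(1)] Suc.prems] Suc.IH[of "Suc i"]
  show ?case by simp
qed

text \<open>The image of a prefix of \<open>W\<close> is this prefix times \<open>t\<close> times
  the inverse of \<open>c\<close>, where \<open>t\<close> is the vertex reached. A long
  \<open>t\<close> begins with the next letters of \<open>W\<close>, and the inverse of
  \<open>c\<close> affects only its end; so nothing cancels against the prefix and the agreement
  grows.\<close>

lemma attracting_ray: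
  assumes c: "c \<in> Fn n" and g: "g \<in> Fn n" "run c g = v" and v: "infinite_line v"
  shows "attracting n (conj_endo c f) (inf_mult g (ray v))"
    and "\<exists>a b. \<forall>i. run c (prefix (a + i) (inf_mult g (ray v))) = (flow ^^ (b + i)) v"
proof -
  define W where "W = inf_mult g (ray v)"
  note ray = ray_in_inf_words[OF v]
  have W: "W \<in> inf_words n" using inf_mult_prefix(1)[OF g(1) ray] by (simp add: W_def)
  obtain a b where ab: "\<And>i. W (a + i) = ray v (b + i)"
      "\<And>i. prefix (a + i) W = mult g (prefix (b + i) (ray v))"
    using inf_mult_prefix(2)[OF g(1) ray] unfolding W_def by blast
  have run: "run c (prefix (a + i) W) = (flow ^^ (b + i)) v" for i
    using mult_cross_run(2)[OF c Fn_letters[OF g(1)], of "prefix (b + i) (ray v)"] g(2)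
      FnD(1)[OF prefix_in_Fn[OF ray]] by (simp add: ab(2) run_ray)
  then show "\<exists>a b. \<forall>i. run c (prefix (a + i) (inf_mult g (ray v))) = (flow ^^ (b + i)) v"
    unfolding W_def by blast
  \<comment> \<open>\<open>M \<ge> 1\<close> secures a first letter of \<open>q\<close>, which shows
    that \<open>prefix j W @ q\<close> is reduced.\<close>
  have key: "\<exists>N. \<forall>j\<ge>N. j + M \<le> lcp_len W (hom (conj_endo c f) (prefix j W))" if M: "M \<ge> 1" for M
  proof -
    obtain N where N: "\<forall>i\<ge>N. Suc (M * img_bound + length c) \<le> length ((flow ^^ i) v)"
      using flow_length_unbounded[OF v] by blast
    have "j + M \<le> lcp_len W (hom (conj_endo c f) (prefix j W))" if j: "j \<ge> a + N" for j
    proof -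
      define i where "i = j - a"
      have ji: "j = a + i" "N \<le> b + i" using j by (auto simp: i_def)
      define t where "t = (flow ^^ (b + i)) v"
      define q where "q = mult t (inverse_w c)"
      have t: "t \<in> Fn n" "Suc (M * img_bound + length c) \<le> length t"
        using N ji flow_pow_in_Fn[OF v] by (auto simp: t_def)
      have "M \<le> M * img_bound" by (simp add: img_bound_def)
      then have Mt: "M + length c < length t" using t by linarith
      then have tq: "take M q = take M t" "M \<le> length q"
        using take_mult[of t M "inverse_w c"] FnD(1)[OF t(1)] unfolding q_def by auto
      have qk: "q ! k = W (j + k)" if "k < M" for k
      proof -
        have "k * img_bound \<le> M * img_bound" using that by simp
        then have "k * img_bound < length t" using t by linarith
        then have "t ! k = W (j + k)"
          using nth_flow_pow[OF v, of k "b + i"] ab(1)[of "i + k"] ji by (simp add: t_def add.assoc)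
        then show ?thesis using tq that by (metis nth_take)
      qed
      have q: "take M q = map (\<lambda>k. W (j + k)) [0..<M]"
        using tq(2) qk by (intro nth_equalityI) simp_all
      have "q \<noteq> []" using tq(2) M by auto
      then have q0: "q \<noteq> []" "hd q = W j"
        using M qk[of 0] hd_conv_nth[of q] by simp_all
      have rP: "reduced (prefix (Suc j) W)" using FnD(1)[OF prefix_in_Fn[OF W]] .
      have rq: "reduced q" using c FnD by (auto simp: q_def intro!: reduced_mult)
      have red: "reduced (prefix j W @ q)"
        using rP rq q0 by (simp add: reduced_append prefix_Suc)
      have "hom (conj_endo c f) (prefix j W) = mult (prefix j W) q"
        using hom_conj_endo[OF c prefix_in_Fn[OF W, of j]] run[of i] ji by (simp add: q_def t_def)
      also have "\<dots> = prefix j W @ q" using red by (rule mult_eq_append)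
      finally have h: "hom (conj_endo c f) (prefix j W) = prefix j W @ q" .
      have "prefix j W @ take M q = prefix (j + M) W"
        unfolding q by (auto simp: list_eq_iff_nth_eq nth_append)
      then show ?thesis using h tq by (simp add: le_lcp_len_iff)
    qed
    then show ?thesis by blast
  qed
  have "\<exists>N. \<forall>j\<ge>N. j + M \<le> lcp_len W (hom (conj_endo c f) (prefix j W))" for M
    using key[of "Suc M"] by (auto intro: Suc_leD)
  with W show "attracting n (conj_endo c f) (inf_mult g (ray v))"
    by (simp add: attracting_iff W_def)
qed

text \<open>Removing \<open>prefix j W\<close> from its image leaves the vertex times the inverse of
  \<open>c\<close>, which begins with \<open>W j\<close>. Multiplying by \<open>c\<close> cannot
  reach the front of so long a word, so the vertex itself begins with the letter that the path takes
  next.\<close>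

lemma attracting_follows_flow:
  assumes c: "c \<in> Fn n" and W: "attracting n (conj_endo c f) W"
  shows "\<exists>N. \<forall>j\<ge>N. run c (prefix j W) \<noteq> [] \<and> hd (run c (prefix j W)) = W j \<and>
     L \<le> length (run c (prefix j W))"
proof -
  have Wi: "W \<in> inf_words n" using W by (simp add: attracting_iff)
  obtain N where N: "\<forall>j\<ge>N. j + (Suc L + length c) \<le> lcp_len W (hom (conj_endo c f) (prefix j W))"
    using W unfolding attracting_iff by blast
  have "run c (prefix j W) \<noteq> [] \<and> hd (run c (prefix j W)) = W j \<and> L \<le> length (run c (prefix j W))"
    if j: "j \<ge> N" for j
  proof -
    let ?P = "prefix j W" and ?h = "hom (conj_endo c f) (prefix j W)"
    define v where "v = run c ?P"
    have P: "?P \<in> Fn n" using prefix_in_Fn[OF Wi] .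
    have v: "v \<in> Fn n" using run_in_Fn[OF c Fn_letters[OF P]] by (simp add: v_def)
    have r: "reduced v" "reduced c" "reduced ?P" using v c P FnD by auto
    let ?q = "mult v (inverse_w c)"
    have q: "?h = mult ?P ?q" using hom_conj_endo[OF c P] by (simp add: v_def)
    have rq: "reduced ?q" using r by (simp add: reduced_mult)
    have len: "j + (Suc L + length c) \<le> length ?h"
      and tk: "take (j + (Suc L + length c)) ?h = prefix (j + (Suc L + length c)) W"
      using N j unfolding le_lcp_len_iff by blast+
    have "take j ?h = ?P" using arg_cong[OF tk, of "take j"] by (simp add: take_prefix)
    then have hP: "?h = ?P @ drop j ?h" by (metis append_take_drop_id)
    have rh: "reduced ?h" using q rq by (simp add: reduced_mult)
    have "?q = mult (inverse_w ?P) ?h" using q rq by (simp add: mult_inverse_cancel)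
    also have "\<dots> = mult (inverse_w ?P) (mult ?P (drop j ?h))"
      using hP rh by (metis mult_eq_append)
    also have "\<dots> = drop j ?h"
      using rh hP by (metis mult_inverse_cancel reduced_append)
    finally have qd: "?q = drop j ?h" .
    have q_len: "Suc L + length c \<le> length ?q" using qd len by simp
    have q0: "hd ?q = W j"
      using arg_cong[OF tk, of "\<lambda>w. w ! j"] len by (simp add: qd hd_drop_conv_nth)
    have "mult ?q c = v" using r by (simp add: mult_assoc mult_inverse_left mult_Nil2)
    then have "take (Suc L) v = take (Suc L) ?q" "Suc L \<le> length v"
      using take_mult[OF rq q_len] by simp_all
    then have "hd v = hd ?q" "v \<noteq> []" "L \<le> length v"
      by (metis hd_take zero_less_Suc, auto)
    then show ?thesis using q0 by (simp add: v_def)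
  qed
  then show ?thesis by blast
qed

text \<open>A path that follows the flow cannot leave a finite subgraph with empty outflow, whereas
  the vertices of an attracting word become arbitrarily long.\<close>

lemma no_attracting:
  assumes c: "c \<in> Fn n" and i: "index (component c) \<ge> 1"
  shows "\<not> attracting n (conj_endo c f) W"
proof
  assume W: "attracting n (conj_endo c f) W"
  then have Wi: "W \<in> inf_words n" by (simp add: attracting_iff)
  let ?v = "\<lambda>j. run c (prefix j W)"
  obtain N where N: "\<forall>j\<ge>N. ?v j \<noteq> [] \<and> hd (?v j) = W j"
    using attracting_follows_flow[OF c W, of 0] by blast
  obtain V0 R0 p0 where V0: "tree c V0 R0 p0" "full c V0" using ex_full_tree c by blast
  have "c \<in> V0" using tree_props[OF V0(1) c] by blast
  from tree_extend[OF V0(1) c this Fn_letters[OF prefix_in_Fn[OF Wi, of N]]]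
  obtain V R p where V: "tree c V R p" "V0 \<subseteq> V" "\<forall>i. run c (take i (prefix N W)) \<in> V" by blast
  note P = tree_props[OF V(1) c]
  have out: "outflow V = {}"
    using tree_index_ge_1(2)[OF V(1) full_mono[OF V0(2) V(2)] c i] P by simp
  have VN: "?v j \<in> V" if "j \<ge> N" for j
    using that
  proof (induction j rule: dec_induct)
    case base
    then show ?case using V(3)[rule_format, of N] by (simp add: take_prefix)
  next
    case (step j)
    have "?v (Suc j) = flow (?v j)"
      using N step by (simp add: prefix_Suc run_append run_Cons flow_def)
    then show ?case using step N out by (auto simp: outflow_def)
  qed
  obtain L where L: "\<forall>w\<in>V. length w < L"
    using P finite_nat_set_iff_bounded[of "length ` V"] by auto
  obtain N' where "\<forall>j\<ge>N'. L \<le> length (?v j)"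
    using attracting_follows_flow[OF c W, of L] by blast
  then have "L \<le> length (?v (max N N'))" by simp
  with L VN[of "max N N'"] show False by fastforce
qed

subsection \<open>Flow lines that leave a minimal tree\<close>

definition full_tree :: "word \<Rightarrow> word set \<Rightarrow> bool" where
  "full_tree c V \<longleftrightarrow> full c V \<and> (\<exists>R p. tree c V R p)"

definition minimal :: "word \<Rightarrow> word set \<Rightarrow> bool" where
  "minimal c V \<longleftrightarrow> full_tree c V \<and>
     (\<forall>V'. full_tree c V' \<longrightarrow> card (outflow V) \<le> card (outflow V'))"

lemma ex_minimal: "c \<in> Fn n \<Longrightarrow> \<exists>V. minimal c V"
  using ex_full_tree ex_has_least_nat[of "full_tree c" _ "\<lambda>V. card (outflow V)"]
  unfolding minimal_def full_tree_def by blast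

lemma minimal_subset:
  assumes "c \<in> Fn n" "minimal c V"
  shows "finite V" "V \<subseteq> Fn n" "V \<subseteq> component c" "finite (outflow V)"
  using assms component_subset by (auto simp: minimal_def full_tree_def full_def outflow_def)

text \<open>Adding \<open>flow v\<close> takes \<open>v\<close> out of the outflow and can bring in
  only \<open>flow v\<close>. By minimality the outflow does not shrink, so \<open>flow v\<close>
  does enter and no other element drops out.\<close>

lemma minimal_insert_flow:
  assumes c: "c \<in> Fn n" and V: "minimal c V" and v: "v \<in> outflow V"
  shows "minimal c (insert (flow v) V)" "flow v \<in> outflow (insert (flow v) V)"
    "outflow V - {v} \<subseteq> outflow (insert (flow v) V)"
proof -
  let ?u = "flow v"
  let ?V = "insert ?u V"
  note S = minimal_subset[OF c V]
  have v': "v \<in> V" "v \<noteq> []" "?u \<notin> V" "v \<in> Fn n" using v S by (auto simp: outflow_def)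
  have x: "fst (hd v) < n" using v' by (simp add: hd_Fn)
  obtain R p where "tree c V R p" using V by (auto simp: minimal_def full_tree_def)
  from extend[OF this v'(1) x] v' have "\<exists>R p. tree c ?V R p" by (auto simp: flow_def)
  moreover have "?u \<in> component c" using component_step[OF c _ x] v' S by (auto simp: flow_def)
  then have "full c ?V"
    using V S full_mono[of c V ?V] by (auto simp: minimal_def full_tree_def)
  ultimately have ft: "full_tree c ?V" by (simp add: full_tree_def)
  have sub: "outflow ?V \<subseteq> insert ?u (outflow V - {v})" by (auto simp: outflow_def)
  have fin: "finite (insert ?u (outflow V - {v}))" using S by simp
  have "card (insert ?u (outflow V - {v})) = card (outflow V)"
    using S v v' by (subst card_insert_disjoint) (auto simp: outflow_def card_Suc_Diff1 
      simp del: card_Diff_insert)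
  moreover have "card (outflow V) \<le> card (outflow ?V)" using V ft by (simp add: minimal_def)
  ultimately have eq: "outflow ?V = insert ?u (outflow V - {v})"
    and card: "card (outflow ?V) = card (outflow V)"
    using card_seteq[OF fin sub] by simp_all
  then show "?u \<in> outflow ?V" "outflow V - {v} \<subseteq> outflow ?V" by auto
  show "minimal c ?V" using ft V card by (simp add: minimal_def)
qed

lemma minimal_flow_pow:
  assumes c: "c \<in> Fn n" and V: "minimal c V" and v: "v \<in> outflow V"
  shows "\<exists>V'. minimal c V' \<and> V \<subseteq> V' \<and> (flow ^^ k) v \<in> outflow V' \<and> outflow V - {v} \<subseteq> outflow V' \<and>
    (k > 0 \<longrightarrow> (flow ^^ k) v \<notin> V)"
proof (induction k)
  case 0
  then show ?case using V v by auto
next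
  case (Suc k)
  then obtain V' where V': "minimal c V'" "V \<subseteq> V'" "(flow ^^ k) v \<in> outflow V'"
    "outflow V - {v} \<subseteq> outflow V'" "k > 0 \<longrightarrow> (flow ^^ k) v \<notin> V" by blast
  let ?w = "(flow ^^ k) v"
  note M = minimal_insert_flow[OF c V'(1,3)]
  \<comment> \<open>Thus \<open>?w\<close>, the only vertex that ceases to be an exit, is none of
    the exits to be preserved.\<close>
  have "?w \<notin> outflow V - {v}"
    using V'(5) by (cases "k = 0") (auto simp: outflow_def)
  then have "outflow V - {v} \<subseteq> outflow (insert (flow ?w) V')" using M(3) V'(4) by blast
  moreover have "flow ?w \<notin> V" using V'(2,3) by (auto simp: outflow_def)
  ultimately show ?case using M V'(2) by (intro exI[of _ "insert (flow ?w) V'"]) auto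
qed

text \<open>After the line of \<open>v\<close> has been absorbed up to step \<open>i\<close>,
  \<open>w\<close> is still an exit and its line never re-enters the tree. A common vertex must then
  be \<open>w\<close> itself, but the line of \<open>v\<close> does not return to
  \<open>V\<close>.\<close>

lemma flow_lines_disjoint:
  assumes c: "c \<in> Fn n" and V: "minimal c V" and v: "v \<in> outflow V" "w \<in> outflow V"
    and eq: "(flow ^^ i) v = (flow ^^ j) w"
  shows "v = w"
proof (rule ccontr)
  assume ne: "v \<noteq> w"
  obtain V' where V': "minimal c V'" "(flow ^^ i) v \<in> outflow V'" "outflow V - {v} \<subseteq> outflow V'"
    "i > 0 \<longrightarrow> (flow ^^ i) v \<notin> V"
    using minimal_flow_pow[OF c V v(1)] by blast
  have w: "w \<in> outflow V'" using V' v ne by auto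
  obtain V'' where "j > 0 \<longrightarrow> (flow ^^ j) w \<notin> V'"
    using minimal_flow_pow[OF c V'(1) w] by blast
  then have "j = 0" using eq V'(2) by (auto simp: outflow_def)
  then have "(flow ^^ i) v = w" using eq by simp
  then show False using V'(4) v ne by (cases "i = 0") (auto simp: outflow_def)
qed

text \<open>Each vertex of the line is an exit of some minimal tree, hence nontrivial, and all later
  vertices lie outside that tree.\<close>

lemma outflow_infinite_line:
  assumes c: "c \<in> Fn n" and V: "minimal c V" and v: "v \<in> outflow V"
  shows "infinite_line v"
proof -
  have "v \<in> Fn n" using v minimal_subset[OF c V] by (auto simp: outflow_def)
  moreover have "(flow ^^ i) v \<noteq> []" for i
    using minimal_flow_pow[OF c V v, of i] by (auto simp: outflow_def)
  moreover have "(flow ^^ i) v \<noteq> (flow ^^ j) v" if "i < j" for i j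
  proof -
    obtain V' where V': "minimal c V'" "(flow ^^ i) v \<in> outflow V'"
      using minimal_flow_pow[OF c V v] by blast
    have "(flow ^^ (j - i)) ((flow ^^ i) v) \<notin> V'"
      using minimal_flow_pow[OF c V', of "j - i"] that by auto
    then have "(flow ^^ j) v \<notin> V'"
      using that by (simp flip: funpow_add[THEN fun_cong, unfolded o_apply])
    then show ?thesis using V' by (auto simp: outflow_def)
  qed
  then have "inj (\<lambda>i. (flow ^^ i) v)" by (rule linorder_injI)
  ultimately show ?thesis by (simp add: infinite_line_def)
qed

lemma outflow_attracting:
  assumes c: "c \<in> Fn n" and V: "minimal c V" and v: "v \<in> outflow V"
  obtains W a b where "attracting n (conj_endo c f) W"
    "\<And>i. run c (prefix (a + i) W) = (flow ^^ (b + i)) v"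
proof -
  have "v \<in> component c" using v minimal_subset[OF c V] by (auto simp: outflow_def)
  then obtain g where g: "g \<in> Fn n" "run c g = v" by (auto simp: component_def)
  from attracting_ray[OF c g outflow_infinite_line[OF c V v]] that show ?thesis by blast
qed

lemma a_num_conj_endo_ge_1:
  assumes "c \<in> Fn n" "minimal c V" "outflow V \<noteq> {}"
  shows "a_num n (conj_endo c f) \<ge> 1"
  using assms outflow_attracting a_num_ge_1 by (metis ex_in_conv)

text \<open>Multiplication by an element of the stabilizer of \<open>c\<close> does not change the vertices that are
  visited eventually, so equivalent words come from the same flow line.\<close>

lemma a_num_conj_endo_ge_2:
  assumes c: "c \<in> Fn n" and V: "minimal c V" and v: "v \<in> outflow V" "w \<in> outflow V" "v \<noteq> w"
  shows "a_num n (conj_endo c f) \<ge> 2"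
proof -
  obtain W a b where W: "attracting n (conj_endo c f) W"
    "\<And>i. run c (prefix (a + i) W) = (flow ^^ (b + i)) v"
    using outflow_attracting[OF c V v(1)] by blast
  obtain W' a' b' where W': "attracting n (conj_endo c f) W'"
    "\<And>i. run c (prefix (a' + i) W') = (flow ^^ (b' + i)) w"
    using outflow_attracting[OF c V v(2)] by blast
  have "inf_mult U W \<noteq> W'" if U: "U \<in> Fix n (conj_endo c f)" for U
  proof
    assume eq: "inf_mult U W = W'"
    have Wi: "W \<in> inf_words n" using W by (simp add: attracting_iff)
    have U': "U \<in> Fn n" "run c U = c" using U c by (auto simp: Fix_conj_endo)
    obtain k l where kl: "\<And>i. prefix (k + i) W' = mult U (prefix (l + i) W)"
      using inf_mult_prefix(2)[OF U'(1) Wi] eq by blast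
    have "run c (prefix (k + i) W') = run c (prefix (l + i) W)" for i
      using mult_cross_run(2)[OF c Fn_letters[OF U'(1)], of "prefix (l + i) W"] U'(2)
        FnD(1)[OF prefix_in_Fn[OF Wi]] by (simp add: kl)
    from this[of "a + a'"] have "(flow ^^ (b' + (k + a))) w = (flow ^^ (b + (l + a'))) v"
      using W(2)[of "l + a'"] W'(2)[of "k + a"] by (simp add: ac_simps)
    then show False using flow_lines_disjoint[OF c V v(2,1)] v(3) by blast
  qed
  with W(1) W'(1) show ?thesis by (rule a_num_ge_2)
qed

text \<open>By \<open>euler\<close>, the edges outside the tree and the exits together number at
  least 2. The former yield rank, the latter inequivalent attracting words.\<close>

lemma rk_add_a_num_ge_2:
  assumes c: "c \<in> Fn n" and i: "index (component c) \<le> -1"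
  shows "rk n (Fix n (conj_endo c f)) + a_num n (conj_endo c f) \<ge> 2"
proof -
  obtain V where V: "minimal c V" using ex_minimal c by blast
  then obtain R p where t: "tree c V R p" and full: "full c V"
    by (auto simp: minimal_def full_tree_def)
  note P = tree_props[OF t c]
  have fin: "finite (outflow V)" "finite (edges V)" using minimal_subset[OF c V] finite_edges by auto
  have "card (edges V - R) = card (edges V) - card R" "card R \<le> card (edges V)"
    using P fin by (auto intro: card_Diff_subset card_mono)
  then have E: "int (card (edges V - R)) + int (card (outflow V)) \<ge> 2"
    using euler[OF c full] P i by linarith
  consider "card (outflow V) \<ge> 2" | "card (outflow V) = 1" | "card (outflow V) = 0" by linarith
  then show ?thesis
  proof cases
    case 1
    then have "\<not> card (outflow V) \<le> Suc 0" by simp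
    then obtain v w where "v \<in> outflow V" "w \<in> outflow V" "v \<noteq> w"
      using card_le_Suc0_iff_eq[OF fin(1)] by blast
    then have "a_num n (conj_endo c f) \<ge> 2" using a_num_conj_endo_ge_2 c V by blast
    then show ?thesis by (metis add.left_neutral add_mono zero_le)
  next
    case 2
    then have "card (edges V - R) \<noteq> 0" using E by linarith
    then have "edges V - R \<noteq> {}" by (metis card.empty)
    then have "rk n (Fix n (conj_endo c f)) \<ge> 1" using rk_Fix_ge_1[OF t c] by blast
    moreover have "a_num n (conj_endo c f) \<ge> 1" using a_num_conj_endo_ge_1[OF c V] 2 by force
    ultimately show ?thesis by (metis add_mono one_add_one)
  next
    case 3
    then have "\<not> card (edges V - R) \<le> Suc 0" using E by simp
    then obtain d e where "d \<in> edges V - R" "e \<in> edges V - R" "d \<noteq> e"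
      using card_le_Suc0_iff_eq fin(2) by (metis finite_Diff)
    then have "rk n (Fix n (conj_endo c f)) \<ge> 2" using rk_Fix_ge_2[OF t c] by blast
    then show ?thesis by (metis add.right_neutral add_mono zero_le)
  qed
qed

end

theorem theorem1p6:
  fixes n :: nat and f :: "nat \<Rightarrow> word"
  assumes "n \<ge> 1"
    and "is_injective_endo n f"
  shows "(trace_ab n f < 1 \<longrightarrow>
            (\<exists>c\<in>Fn n. rk n (Fix n (conj_endo c f)) = 0 \<and> a_num n (conj_endo c f) = 0))
       \<and> (n \<le> 2 \<and> trace_ab n f > 1 \<longrightarrow>
            (\<exists>c\<in>Fn n. rk n (Fix n (conj_endo c f)) + a_num n (conj_endo c f) > 1))"
proof -
  interpret endo n f
    using assms(2) by unfold_locales (simp add: is_injective_endo_def)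
  show ?thesis
  proof (intro conjI impI)
    assume "trace_ab n f < 1"
    then obtain c where c: "c \<in> Fn n" "index (component c) \<ge> 1" by (rule index_ge_1)
    have "a_num n (conj_endo c f) = 0"
      using no_attracting[OF c] by (simp add: a_num_def ecard_def quotient_def zero_enat_def)
    then show "\<exists>c\<in>Fn n. rk n (Fix n (conj_endo c f)) = 0 \<and> a_num n (conj_endo c f) = 0"
      using Fix_trivial[OF c] c(1) by (intro bexI[of _ c]) (simp_all add: rk_singleton_Nil)
  next
    assume "n \<le> 2 \<and> trace_ab n f > 1"
    then obtain c where c: "c \<in> Fn n" "index (component c) \<le> -1" using index_le_minus_1 by blast
    have "(1::enat) < 2" by (simp add: one_enat_def numeral_eq_enat)
    then show "\<exists>c\<in>Fn n. rk n (Fix n (conj_endo c f)) + a_num n (conj_endo c f) > 1"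
      using rk_add_a_num_ge_2[OF c] c(1) by (meson order_less_le_trans)
  qed
qed

end
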